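(* A meromorphic function $f$ on $\mathbb{C}$ with divisor $D=((a_n),(b_n))$ belongs to ${\cal N}_1$ if and only if: (a) for every $\delta>0$ there is $C_\delta<\infty$ with $1/C_\delta\le|f(z)|\le C_\delta$ for all $z\notin A(\delta)$; (b) $\inf_{n,k}|a_n-b_k|>0$; there is $C_0$ with ${\rm card}\{n:|a_n-c|\le1\}+{\rm card}\{n:|b_n-c|\le1\}<C_0$ for all $c\in\mathbb{C}$; and there is $R_0<\infty$ such that every disc $B(w,R_0)$, $w\in\mathbb{C}$, contains some $a_n$ and some $b_k$.
   Context: $\rho_S$ is the spherical metric. A meromorphic $f$ on $\mathbb{C}$ is normal if every sequence $(h_n)\subset\mathbb{C}$ has a subsequence $(h_{n'})$ with $\rho_S(f(z+h_{n'}),f(z+h_{m'}))\to0$ uniformly on compacta; $f\in{\cal N}_1$ if $f$ is normal and no limit (uniform on compacta in $\rho_S$) of translates $f(z+h_n)$ is constant (including $\infty$). The divisor lists zeros $a_n$ and poles $b_n$ with multiplicity. $A(\delta)=\bigcup_nB(a_n,\delta)\cup\bigcup_nB(b_n,\delta)$, $B(c,r)=\{|z-c|<r\}$. *)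

theory Defs
  imports "HOL-Analysis.Analysis"
begin

text \<open>A meromorphic function on the whole plane is represented as a map into
  the extended plane: None stands for the value infinity (a pole).\<close>

definition poles :: "(complex \<Rightarrow> complex option) \<Rightarrow> complex set" where
  "poles f = {z. f z = None}"

definition zeros :: "(complex \<Rightarrow> complex option) \<Rightarrow> complex set" where
  "zeros f = {z. f z = Some 0}"

definition meromorphic_C :: "(complex \<Rightarrow> complex option) \<Rightarrow> bool" where
  "meromorphic_C f \<longleftrightarrow>
     (\<forall>z. \<not> z islimpt poles f) \<and>
     (\<lambda>z. the (f z)) holomorphic_on (- poles f) \<and>
     (\<forall>p\<in>poles f. filterlim (\<lambda>z. norm (the (f z))) at_top (at p))"

definition recip :: "(complex \<Rightarrow> complex option) \<Rightarrow> complex \<Rightarrow> complex option" where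
  "recip f z = (case f z of None \<Rightarrow> Some 0 | Some w \<Rightarrow> (if w = 0 then None else Some (1 / w)))"

definition zero_mult :: "(complex \<Rightarrow> complex option) \<Rightarrow> complex \<Rightarrow> nat" where
  "zero_mult f z0 = (LEAST n. (deriv ^^ n) (\<lambda>z. the (f z)) z0 \<noteq> 0)"

definition pole_mult :: "(complex \<Rightarrow> complex option) \<Rightarrow> complex \<Rightarrow> nat" where
  "pole_mult f p = zero_mult (recip f) p"

definition rho_S :: "complex option \<Rightarrow> complex option \<Rightarrow> real" where
  "rho_S u v = (case (u, v) of
      (Some a, Some b) \<Rightarrow> 2 * cmod (a - b) / (sqrt (1 + (cmod a)\<^sup>2) * sqrt (1 + (cmod b)\<^sup>2))
    | (Some a, None) \<Rightarrow> 2 / sqrt (1 + (cmod a)\<^sup>2)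
    | (None, Some b) \<Rightarrow> 2 / sqrt (1 + (cmod b)\<^sup>2)
    | (None, None) \<Rightarrow> 0)"

definition normal_C :: "(complex \<Rightarrow> complex option) \<Rightarrow> bool" where
  "normal_C f \<longleftrightarrow> (\<forall>h :: nat \<Rightarrow> complex. \<exists>r :: nat \<Rightarrow> nat. strict_mono r \<and>
     (\<forall>K. compact K \<longrightarrow> (\<forall>\<epsilon>>0. \<exists>N. \<forall>m\<ge>N. \<forall>n\<ge>N. \<forall>z\<in>K.
        rho_S (f (z + h (r n))) (f (z + h (r m))) < \<epsilon>)))"

definition N1 :: "(complex \<Rightarrow> complex option) \<Rightarrow> bool" where
  "N1 f \<longleftrightarrow> normal_C f \<and>
     \<not> (\<exists>(h :: nat \<Rightarrow> complex) (c :: complex option).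
          \<forall>K. compact K \<longrightarrow> (\<forall>\<epsilon>>0. \<exists>N. \<forall>n\<ge>N. \<forall>z\<in>K. rho_S (f (z + h n)) c < \<epsilon>))"

end

(*
  Translates of a function in the class form a family that is precompact for locally uniform
  spherical convergence, and all limits are nowhere locally constant.  If |f| were small far from
  the zeros, Hurwitz's theorem applied to a limit of translates would produce a nearby zero; the
  reciprocal 1/f gives the upper bound, so (a) holds.  Uniform continuity of f into the sphere
  separates zeros from poles.  On a small disc about a zero |f| <= 1, while somewhere in the disc
  |f| >= m with m independent of the disc, so dividing out the zeros and using the maximum modulus
  principle bounds their number.  If discs of arbitrary radius contained no zero, a limit of
  translates would be bounded away from 0 everywhere, hence constant by Liouville's theorem.

  Conversely, every small disc is free of poles (or of zeros; then use 1/f), and since it contains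
  boundedly many points of the divisor there is a concentric circle staying a fixed distance away
  from all of them.  There |f| <= C by (a), so f is bounded inside by the maximum principle and
  Lipschitz by Cauchy's estimate; Arzela-Ascoli gives normality.  A constant limit of translates
  would be close to both 0 and infinity because every disc of radius R_0 contains a zero and a pole.
*)
theory Submission
  imports Defs "HOL-Complex_Analysis.Complex_Analysis"
begin

section \<open>Chordal distance as Euclidean distance on the unit sphere, and inversion as a
  rotation\<close>

section \<open>The Riemann sphere\<close>

text \<open>Inverse stereographic projection onto the unit sphere of
  \<open>complex \<times> real\<close>, with infinity as north pole. It moves spherical convergence
  into a Euclidean space, where completeness, compactness and uniform limits are at hand.\<close>

fun stereo :: "complex option \<Rightarrow> complex \<times> real" where
  "stereo None = (0, 1)"
| "stereo (Some a) =
     (2 * a / of_real (1 + (cmod a)\<^sup>2), ((cmod a)\<^sup>2 - 1) / (1 + (cmod a)\<^sup>2))"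

lemma one_plus_norm_sq_pos: "1 + (norm (x :: 'a :: real_normed_vector))\<^sup>2 > 0"
  by (smt (verit) zero_le_power2)

lemma norm_stereo [simp]: "norm (stereo u) = 1"
proof (cases u)
  case (Some a)
  have "(norm (stereo (Some a)))\<^sup>2
      = ((2 * cmod a)\<^sup>2 + ((cmod a)\<^sup>2 - 1)\<^sup>2) / (1 + (cmod a)\<^sup>2)\<^sup>2"
    using one_plus_norm_sq_pos[of a]
    by (simp add: norm_Pair norm_divide norm_mult power_divide add_divide_distrib
        del: of_real_add of_real_power)
  also have "(2 * cmod a)\<^sup>2 + ((cmod a)\<^sup>2 - 1)\<^sup>2 = (1 + (cmod a)\<^sup>2)\<^sup>2"
    by (simp add: power2_eq_square algebra_simps)
  also have "\<dots> / (1 + (cmod a)\<^sup>2)\<^sup>2 = 1"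
    using one_plus_norm_sq_pos[of a] by simp
  finally show ?thesis
    using Some by (simp add: power2_eq_1_iff del: stereo.simps)
      (smt (verit) norm_ge_zero)
qed (simp add: norm_Pair)

lemma dist_sq_of_norm_one:
  fixes x y :: "'a :: real_inner"
  assumes "norm x = 1" "norm y = 1"
  shows "(dist x y)\<^sup>2 = 2 - 2 * (x \<bullet> y)"
  using assms by (simp add: dist_norm power2_norm_eq_inner inner_diff inner_commute norm_eq_1)

text \<open>Both sides are nonnegative, so squares may be compared; for unit vectors the squared
  distance is determined by the inner product. The triangle inequality for \<open>rho_S\<close>
  comes for free from this.\<close>

lemma rho_S_eq_dist: "rho_S u v = dist (stereo u) (stereo v)"
proof -
  have aux: "rho_S (Some a) None = dist (stereo (Some a)) (stereo None)" for a
  proof (rule power2_eq_imp_eq)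
    show "(rho_S (Some a) None)\<^sup>2 = (dist (stereo (Some a)) (stereo None))\<^sup>2"
      using one_plus_norm_sq_pos[of a]
      by (simp add: dist_sq_of_norm_one del: stereo.simps(2))
        (simp add: rho_S_def power_divide inner_Pair field_simps)
  qed (auto simp: rho_S_def)
  have aux2: "rho_S (Some a) (Some b) = dist (stereo (Some a)) (stereo (Some b))" for a b
  proof (rule power2_eq_imp_eq)
    let ?A = "1 + (cmod a)\<^sup>2" and ?B = "1 + (cmod b)\<^sup>2"
    have inn: "stereo (Some a) \<bullet> stereo (Some b)
      = (4 * (a \<bullet> b) + ((cmod a)\<^sup>2 - 1) * ((cmod b)\<^sup>2 - 1)) / (?A * ?B)"
    proof -
      have "2 * a / of_real ?A = (2 / ?A) *\<^sub>R a" "2 * b / of_real ?B = (2 / ?B) *\<^sub>R b"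
        by (simp_all add: scaleR_conv_of_real)
      hence "stereo (Some a) \<bullet> stereo (Some b)
        = (2 / ?B) * ((2 / ?A) * (a \<bullet> b)) + (((cmod a)\<^sup>2 - 1) / ?A) * (((cmod b)\<^sup>2 - 1) / ?B)"
        by (simp only: stereo.simps inner_Pair inner_scaleR_left inner_scaleR_right inner_real_def)
      thus ?thesis
        by (simp add: add_divide_distrib mult.commute)
    qed
    have "(rho_S (Some a) (Some b))\<^sup>2 = 4 * (cmod (a - b))\<^sup>2 / (?A * ?B)"
      by (simp add: rho_S_def power_divide power_mult_distrib)
    also have "(cmod (a - b))\<^sup>2 = (cmod a)\<^sup>2 + (cmod b)\<^sup>2 - 2 * (a \<bullet> b)"
      by (simp add: power2_norm_eq_inner inner_diff inner_commute)
    also have "4 * \<dots> = 2 * (?A * ?B) - 2 * (4 * (a \<bullet> b) + ((cmod a)\<^sup>2 - 1) * ((cmod b)\<^sup>2 - 1))"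
      by (simp add: algebra_simps)
    also have "\<dots> / (?A * ?B) = (dist (stereo (Some a)) (stereo (Some b)))\<^sup>2"
      using one_plus_norm_sq_pos[of a] one_plus_norm_sq_pos[of b]
      by (subst dist_sq_of_norm_one) (simp_all only: norm_stereo inn, simp add: diff_divide_distrib)
    finally show "(rho_S (Some a) (Some b))\<^sup>2 = (dist (stereo (Some a)) (stereo (Some b)))\<^sup>2" .
  qed (auto simp: rho_S_def)
  have aux3: "rho_S None (Some a) = dist (stereo None) (stereo (Some a))" for a
    using aux[of a] by (simp add: rho_S_def dist_commute)
  show ?thesis
    by (cases u; cases v) (use aux aux2 aux3 in \<open>simp_all del: stereo.simps(2)\<close>, simp add: rho_S_def)
qed

text \<open>Projection from the north pole back to the plane. At the pole division by zero yields
  the default value 0, so it is only meaningful on sphere points with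
  \<open>snd p < 1\<close>.\<close>

definition stereo_inv :: "complex \<times> real \<Rightarrow> complex" where
  "stereo_inv p = fst p / of_real (1 - snd p)"

lemma snd_stereo_Some:
  "1 - snd (stereo (Some a)) = 2 / (1 + (cmod a)\<^sup>2)"
  using one_plus_norm_sq_pos[of a] by (simp add: field_simps)

lemma snd_stereo_less_iff: "snd (stereo u) < 1 \<longleftrightarrow> u \<noteq> None"
proof (cases u)
  case (Some a)
  have "1 - snd (stereo (Some a)) > 0"
    unfolding snd_stereo_Some using one_plus_norm_sq_pos[of a] by simp
  thus ?thesis using Some by simp
qed simp

lemma stereo_inv_stereo: "u \<noteq> None \<Longrightarrow> stereo_inv (stereo u) = the u"
proof -
  assume "u \<noteq> None"
  then obtain a where u: "u = Some a" by auto
  have "complex_of_real (1 + (cmod a)\<^sup>2) \<noteq> 0"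
    using one_plus_norm_sq_pos[of a] by (metis of_real_eq_0_iff less_irrefl)
  thus ?thesis
    unfolding stereo_inv_def u snd_stereo_Some by (simp del: of_real_add)
qed

lemma inj_stereo: "stereo u = stereo v \<longleftrightarrow> u = v"
  by (metis option.expand snd_stereo_less_iff stereo_inv_stereo)

text \<open>Since the sphere is closed, surjectivity lets a limit of sphere points be read again as
  a point of the extended plane. The preimage of \<open>(x, t)\<close> with \<open>t < 1\<close> is
  \<open>x / (1 - t)\<close>.\<close>

lemma range_stereo: "range stereo = sphere 0 1"
proof
  show "sphere 0 1 \<subseteq> range stereo"
  proof
    fix p :: "complex \<times> real" assume "p \<in> sphere 0 1"
    obtain x t where p: "p = (x, t)" by (cases p)
    have 1: "(cmod x)\<^sup>2 + t\<^sup>2 = 1"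
      using \<open>p \<in> _\<close> by (simp add: p norm_Pair)
    show "p \<in> range stereo"
    proof (cases "t = 1")
      case True
      with 1 have "p = stereo None" by (simp add: p)
      thus ?thesis by blast
    next
      case False
      hence t: "1 - t > 0"
        using 1 by (smt (verit) power2_eq_square zero_le_power2 power2_le_imp_le one_power2)
      have A: "1 + (cmod (x / of_real (1 - t)))\<^sup>2 = 2 / (1 - t)"
      proof -
        have "(cmod x)\<^sup>2 = (1 - t) * (1 + t)"
          using 1 by (simp add: power2_eq_square algebra_simps)
        hence "(cmod (x / of_real (1 - t)))\<^sup>2 = (1 + t) / (1 - t)"
          using t by (simp add: norm_divide power_divide del: of_real_diff)
            (simp add: power2_eq_square)
        thus ?thesis using t by (simp add: field_simps)
      qed
      have B: "(cmod (x / of_real (1 - t)))\<^sup>2 - 1 = 2 / (1 - t) - 2"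
        using A by simp
      have "complex_of_real (1 - t) \<noteq> 0"
        using t by (metis of_real_eq_0_iff less_irrefl)
      hence "stereo (Some (x / of_real (1 - t))) = p"
        using t unfolding stereo.simps A B p by (simp add: field_simps)
      thus ?thesis by (metis rangeI)
    qed
  qed
qed auto

text \<open>\<open>recip\<close> acts pointwise, so a constant function evaluated at the arbitrary
  point 0 gives inversion on the extended plane itself.\<close>

abbreviation recip_pt :: "complex option \<Rightarrow> complex option" where
  "recip_pt u \<equiv> recip (\<lambda>_. u) 0"

lemma recip_eq: "recip f z = recip_pt (f z)"
  by (simp add: recip_def)

lemma recip_recip [simp]: "recip (recip f) = f"
  by (rule ext) (auto simp: recip_def split: option.splits)

lemma recip_pt_recip_pt [simp]: "recip_pt (recip_pt u) = u"
  by (auto simp: recip_def split: option.splits)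

lemma recip_eq_None_iff [simp]: "recip f z = None \<longleftrightarrow> f z = Some 0"
  by (auto simp: recip_def split: option.splits)

lemma recip_eq_zero_iff [simp]: "recip f z = Some 0 \<longleftrightarrow> f z = None"
  by (auto simp: recip_def split: option.splits)

lemma zeros_recip [simp]: "zeros (recip f) = poles f"
  and poles_recip [simp]: "poles (recip f) = zeros f"
  by (auto simp: zeros_def poles_def)

text \<open>Inversion is a half turn of the sphere about its real axis, hence an isometry. This is
  what transfers every result about zeros to poles.\<close>

lemma stereo_recip: "stereo (recip f z) = (cnj (fst (stereo (f z))), - snd (stereo (f z)))"
proof (cases "f z")
  case (Some a)
  show ?thesis
  proof (cases "a = 0")
    case False
    let ?A = "(cmod a)\<^sup>2"
    have A: "?A > 0" using False by simp
    have inv: "1 / a = cnj a / of_real ?A"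
      using False by (simp add: complex_div_cnj[of 1 a] del: of_real_power)
    have n: "(cmod (1 / a))\<^sup>2 = 1 / ?A"
      by (simp add: norm_divide power_divide)
    have 1: "1 + 1 / ?A = (1 + ?A) / ?A" and 2: "1 / ?A - 1 = (1 - ?A) / ?A"
      using A by (simp_all add: field_simps)
    have nz: "complex_of_real ?A \<noteq> 0" "complex_of_real (1 + ?A) \<noteq> 0"
      using A one_plus_norm_sq_pos[of a] by (metis of_real_eq_0_iff less_irrefl)+
    have "recip f z = Some (1 / a)" using Some False by (simp add: recip_def)
    hence "stereo (recip f z) = (2 * (1 / a) / of_real (1 + 1 / ?A), (1 / ?A - 1) / (1 + 1 / ?A))"
      by (simp only: stereo.simps n)
    also have "\<dots> = (2 * cnj a / of_real (1 + ?A), (1 - ?A) / (1 + ?A))"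
      unfolding 1 2 unfolding inv
      using nz A one_plus_norm_sq_pos[of a] by (simp del: of_real_add of_real_power)
    also have "\<dots> = (cnj (fst (stereo (f z))), - snd (stereo (f z)))"
      using Some by (simp add: minus_divide_left)
    finally show ?thesis .
  qed (simp add: Some recip_def)
qed (simp add: recip_def)

lemma rho_S_recip [simp]: "rho_S (recip f z) (recip g w) = rho_S (f z) (g w)"
proof -
  have "dist (cnj a, - b) (cnj c, - d) = dist (a, b) (c, d)" for a c :: complex and b d :: real
    by (simp add: dist_Pair_Pair dist_complex_def dist_real_def abs_minus_commute flip: complex_cnj_diff)
  thus ?thesis
    by (simp add: rho_S_eq_dist stereo_recip)
qed

lemma continuous_stereo_Some: "continuous_on UNIV (\<lambda>a. stereo (Some a))"
proof -
  have "complex_of_real (1 + (cmod a)\<^sup>2) \<noteq> 0" "1 + (cmod a)\<^sup>2 \<noteq> 0" for a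
    using one_plus_norm_sq_pos[of a] by (metis of_real_eq_0_iff less_irrefl)+
  thus ?thesis
    unfolding stereo.simps by (intro continuous_intros) auto
qed

lemma rho_S_Some_le: "rho_S (Some a) (Some b) \<le> 2 * cmod (a - b)"
proof -
  have "sqrt (1 + (cmod a)\<^sup>2) \<ge> 1" "sqrt (1 + (cmod b)\<^sup>2) \<ge> 1" by auto
  hence "sqrt (1 + (cmod a)\<^sup>2) * sqrt (1 + (cmod b)\<^sup>2) \<ge> 1 * 1"
    by (intro mult_mono) auto
  thus ?thesis
    unfolding rho_S_def by (simp add: divide_le_eq) (smt (verit) mult_left_le norm_ge_zero mult_le_cancel_left1)
qed

lemma rho_S_Some_zero: "rho_S (Some a) (Some 0) = 2 * cmod a / sqrt (1 + (cmod a)\<^sup>2)"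
  by (simp add: rho_S_def)

lemma rho_S_zero_infinity: "rho_S (Some 0) None = 2"
  by (simp add: rho_S_def)

lemma rho_S_zero_le_imp:
  assumes "rho_S (Some a) (Some 0) \<ge> m" shows "cmod a \<ge> m / 2"
  using rho_S_Some_le[of a 0] assms by simp

text \<open>Infinity has distance 2 from 0, and \<open>|a| \<ge> 1\<close> gives
  \<open>2 * |a| \<ge> sqrt (1 + |a|^2)\<close>, that is, distance at least 1. The bound 1 on the
  modulus is crude but is the normalisation used in counting zeros.\<close>

lemma rho_S_zero_less_imp:
  assumes "rho_S u (Some 0) < 1" shows "u \<noteq> None" "cmod (the u) < 1"
proof -
  show u: "u \<noteq> None"
    using assms by (cases u) (auto simp: rho_S_def)
  then obtain a where a: "u = Some a" by auto
  show "cmod (the u) < 1"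
  proof (rule ccontr)
    assume "\<not> ?thesis"
    hence 1: "cmod a \<ge> 1" using a by simp
    have "1 + (cmod a)\<^sup>2 \<le> (2 * cmod a)\<^sup>2"
      by (simp add: power_mult_distrib) (use one_le_power[OF 1, of 2] in linarith)
    hence "sqrt (1 + (cmod a)\<^sup>2) \<le> 2 * cmod a" by (intro real_le_lsqrt) auto
    hence "rho_S u (Some 0) \<ge> 1"
      using one_plus_norm_sq_pos[of a] by (simp add: a rho_S_Some_zero)
    thus False using assms by simp
  qed
qed

section \<open>Two-chart holomorphy, continuity and the identity theorem\<close>

section \<open>Maps that are holomorphic into the sphere\<close>

definition finite_holo_at :: "(complex \<Rightarrow> complex option) \<Rightarrow> complex \<Rightarrow> bool" where
  "finite_holo_at g z \<longleftrightarrow> (\<exists>r>0. (\<forall>w\<in>ball z r. g w \<noteq> None) \<and> (\<lambda>w. the (g w)) holomorphic_on ball z r)"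

text \<open>The charts are \<open>g\<close> and \<open>1/g\<close>. Unlike
  \<open>meromorphic_C\<close>, this admits the constant infinity, which makes the class closed
  under locally uniform spherical limits.\<close>

definition sphere_holo :: "(complex \<Rightarrow> complex option) \<Rightarrow> bool" where
  "sphere_holo g \<longleftrightarrow> (\<forall>z. finite_holo_at g z \<or> finite_holo_at (recip g) z)"

lemma finite_holo_atE:
  assumes "finite_holo_at g z"
  obtains r where "r > 0" "\<forall>w\<in>ball z r. g w \<noteq> None" "(\<lambda>w. the (g w)) holomorphic_on ball z r"
  using assms unfolding finite_holo_at_def by (elim exE conjE)

lemma sphere_holo_recip: "sphere_holo g \<Longrightarrow> sphere_holo (recip g)"
  unfolding sphere_holo_def by auto

lemma the_recip_nonzero: "g z \<noteq> Some 0 \<Longrightarrow> the (g z) = 1 / the (recip g z) \<or> g z = None"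
  by (auto simp: recip_def split: option.splits)

text \<open>Change of chart: \<open>1/g\<close> does not vanish at \<open>z\<close>, hence not near
  \<open>z\<close> by continuity, so it can be inverted on a smaller disc.\<close>

lemma finite_holo_at_of_recip:
  assumes "finite_holo_at (recip g) z" "g z \<noteq> None"
  shows "finite_holo_at g z"
proof -
  let ?u = "\<lambda>w. the (recip g w)"
  obtain r where r: "r > 0" "\<forall>w\<in>ball z r. recip g w \<noteq> None" "?u holomorphic_on ball z r"
    using assms(1) by (rule finite_holo_atE)
  have "recip g z \<noteq> Some 0" using assms(2) by simp
  hence u0: "?u z \<noteq> 0" using r(2) r(1) by (metis centre_in_ball option.collapse)
  have "continuous_on (ball z r) ?u"
    using r(3) by (rule holomorphic_on_imp_continuous_on)
  hence "isCont ?u z" using r(1) by (simp add: continuous_on_eq_continuous_at)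
  from continuous_at_avoid[OF this u0]
  obtain e where e: "e > 0" "\<And>w. dist z w < e \<Longrightarrow> ?u w \<noteq> 0" by blast
  let ?s = "min r e"
  have fin: "g w \<noteq> None" if "w \<in> ball z ?s" for w
    using e(2)[of w] r(2) that by (metis min_less_iff_conj mem_ball option.sel recip_eq_zero_iff)
  have "(\<lambda>w. 1 / ?u w) holomorphic_on ball z ?s"
    using r(3) e(2) by (intro holomorphic_intros) (auto intro: holomorphic_on_subset)
  moreover have "1 / ?u w = the (g w)" if "w \<in> ball z ?s" for w
    using fin[OF that] r(2) that the_recip_nonzero[of g w] by auto
  ultimately have "(\<lambda>w. the (g w)) holomorphic_on ball z ?s"
    by (rule holomorphic_transform)
  thus ?thesis
    unfolding finite_holo_at_def using fin r(1) e(1) by (intro exI[of _ ?s]) auto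
qed

lemma sphere_holo_imp_finite_holo_at:
  "sphere_holo g \<Longrightarrow> g z \<noteq> None \<Longrightarrow> finite_holo_at g z"
  by (auto simp: sphere_holo_def dest: finite_holo_at_of_recip)

lemma finite_holo_at_imp_differentiable:
  assumes "finite_holo_at g z" shows "(\<lambda>w. the (g w)) field_differentiable at z"
  using assms
proof (rule finite_holo_atE)
  fix r assume "r > 0" and hol: "(\<lambda>w. the (g w)) holomorphic_on ball z r"
  thus ?thesis
    using holomorphic_on_imp_differentiable_at[OF hol open_ball] by simp
qed

lemma sphere_holo_imp_holomorphic_on:
  assumes "sphere_holo g" "\<And>z. z \<in> S \<Longrightarrow> g z \<noteq> None"
  shows "(\<lambda>w. the (g w)) holomorphic_on S"
  unfolding holomorphic_on_def
  using finite_holo_at_imp_differentiable[OF sphere_holo_imp_finite_holo_at[OF assms(1)]] assms(2)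
  by (blast intro: field_differentiable_at_within)

lemma sphere_holo_translate:
  assumes "sphere_holo g" shows "sphere_holo (\<lambda>z. g (z + h))"
proof -
  have *: "finite_holo_at (\<lambda>z. g (z + h)) z" if fin: "finite_holo_at g (z + h)" for g z
  proof -
    obtain r where r: "r > 0" "\<forall>w\<in>ball (z + h) r. g w \<noteq> None"
        "(\<lambda>w. the (g w)) holomorphic_on ball (z + h) r"
      using fin by (rule finite_holo_atE)
    have im: "(\<lambda>w. w + h) ` ball z r \<subseteq> ball (z + h) r" by (auto simp: dist_norm)
    have "((\<lambda>w. the (g w)) \<circ> (\<lambda>w. w + h)) holomorphic_on ball z r"
      by (rule holomorphic_on_compose_gen[OF _ r(3) im]) (intro holomorphic_intros)
    thus ?thesis
      unfolding finite_holo_at_def using r(1,2) im by (intro exI[of _ r]) (auto simp: o_def)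
  qed
  have "recip (\<lambda>z. g (z + h)) = (\<lambda>z. recip g (z + h))" by (auto simp: recip_def)
  thus ?thesis
    using assms *[of g] *[of "recip g"] unfolding sphere_holo_def by metis
qed

lemma isCont_stereo:
  assumes "finite_holo_at g z" shows "isCont (\<lambda>w. stereo (g w)) z"
proof -
  obtain r where r: "r > 0" "\<forall>w\<in>ball z r. g w \<noteq> None"
      "(\<lambda>w. the (g w)) holomorphic_on ball z r"
    using assms by (rule finite_holo_atE)
  have "continuous_on (ball z r) (\<lambda>w. stereo (Some (the (g w))))"
    by (rule continuous_on_compose2[OF continuous_stereo_Some holomorphic_on_imp_continuous_on[OF r(3)]]) auto
  moreover have "stereo (Some (the (g w))) = stereo (g w)" if "w \<in> ball z r" for w
    using r(2) that by simp
  ultimately have "continuous_on (ball z r) (\<lambda>w. stereo (g w))"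
    by (rule continuous_on_eq)
  thus ?thesis using r(1) by (simp add: continuous_on_eq_continuous_at)
qed

lemma continuous_on_stereo:
  assumes "sphere_holo g" shows "continuous_on S (\<lambda>w. stereo (g w))"
proof (rule continuous_at_imp_continuous_on, intro ballI)
  fix z
  show "isCont (\<lambda>w. stereo (g w)) z"
  proof (cases "finite_holo_at g z")
    case False
    hence "isCont (\<lambda>w. stereo (recip g w)) z"
      using assms isCont_stereo sphere_holo_def by blast
    hence "isCont (\<lambda>w. (cnj (fst (stereo (recip g w))), - snd (stereo (recip g w)))) z"
      by (intro continuous_intros)
    thus ?thesis by (simp flip: stereo_recip)
  qed (rule isCont_stereo)
qed

text \<open>A disc around \<open>z\<close> on which \<open>g\<close> is finite and holomorphic meets
  \<open>T\<close> in an open set, and analytic continuation spreads the constant over the disc.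
  \<open>T\<close> enters through an equation so that the same set can be described by
  \<open>g\<close> or by \<open>recip g\<close>.\<close>

lemma finite_holo_at_identity:
  assumes "finite_holo_at g z" and "z \<in> closure T"
    and T: "T = {w. \<exists>r>0. \<forall>v\<in>ball w r. g v = c}"
  shows "z \<in> T"
proof -
  obtain r where r: "r > 0" "\<forall>w\<in>ball z r. g w \<noteq> None"
      "(\<lambda>w. the (g w)) holomorphic_on ball z r"
    using assms(1) by (rule finite_holo_atE)
  obtain t where t: "t \<in> T" "dist t z < r"
    using assms(2) r(1) by (auto simp: closure_approachable)
  then obtain s where s: "s > 0" "\<forall>v\<in>ball t s. g v = c" using T by auto
  have tz: "t \<in> ball z r" using t(2) by (simp add: dist_commute)
  have c: "c \<noteq> None" using r(2) tz s by force
  have "the (g w) = the c" if "w \<in> ball z r" for w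
  proof (rule analytic_continuation_open[of "ball t s \<inter> ball z r" "ball z r" "\<lambda>w. the (g w)" "\<lambda>_. the c" w])
    show "ball t s \<inter> ball z r \<noteq> {}" using tz s(1) by (metis IntI centre_in_ball empty_iff)
  qed (use s(2) r(3) that in auto)
  hence "g w = c" if "w \<in> ball z r" for w
    using bspec[OF r(2) that] c that by (intro option.expand) auto
  thus ?thesis using T r(1) by blast
qed

text \<open>The points near which \<open>g\<close> is constantly \<open>c\<close> form a nonempty
  open and closed subset of the connected plane. Closedness is checked in whichever chart is finite
  at the limit point.\<close>

lemma sphere_holo_identity:
  assumes "sphere_holo g" "open S" "S \<noteq> {}" "\<And>z. z \<in> S \<Longrightarrow> g z = c"
  shows "g z = c"
proof -
  define T where "T = {w. \<exists>r>0. \<forall>v\<in>ball w r. g v = c}"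
  have "open T"
  proof (rule openI)
    fix w assume "w \<in> T"
    then obtain r where r: "r > 0" "\<forall>v\<in>ball w r. g v = c" by (auto simp: T_def)
    have "ball w r \<subseteq> T"
    proof
      fix v assume "v \<in> ball w r"
      then obtain s where "s > 0" "ball v s \<subseteq> ball w r" using openE[OF open_ball] by metis
      thus "v \<in> T" using r unfolding T_def by blast
    qed
    thus "\<exists>e>0. ball w e \<subseteq> T" using r(1) by blast
  qed
  moreover have "closed T"
  proof -
    have "closure T \<subseteq> T"
    proof
      fix w assume w: "w \<in> closure T"
      consider "finite_holo_at g w" | "finite_holo_at (recip g) w"
        using assms(1) sphere_holo_def by blast
      thus "w \<in> T"
      proof cases
        case 1 thus ?thesis using finite_holo_at_identity[OF _ w T_def] by blast
      next
        case 2
        have "T = {w. \<exists>r>0. \<forall>v\<in>ball w r. recip g v = recip_pt c}"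
        proof -
          have "recip g v = recip_pt c \<longleftrightarrow> g v = c" for v
            by (metis recip_eq recip_recip)
          thus ?thesis by (simp add: T_def)
        qed
        thus ?thesis using finite_holo_at_identity[OF 2 w] by blast
      qed
    qed
    thus ?thesis by (simp add: closure_subset_eq)
  qed
  moreover have "T \<noteq> {}"
  proof -
    obtain s where s: "s \<in> S" using assms(3) by blast
    then obtain r where "r > 0" "ball s r \<subseteq> S" using assms(2) openE by blast
    hence "s \<in> T" using assms(4) by (auto simp: T_def)
    thus ?thesis by blast
  qed
  ultimately have "T = UNIV" using clopen by blast
  hence "z \<in> T" by blast
  thus ?thesis by (auto simp: T_def)
qed

text \<open>Off the poles the first chart works. At a pole \<open>1/f\<close> tends to 0, which is
  the value of \<open>recip f\<close> there, so the isolated singularity is removable and the second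
  chart works.\<close>

lemma meromorphic_C_imp_sphere_holo:
  assumes "meromorphic_C f" shows "sphere_holo f"
  unfolding sphere_holo_def
proof
  fix z
  have nolim: "\<not> z islimpt poles f"
    and hol: "(\<lambda>z. the (f z)) holomorphic_on (- poles f)"
    using assms by (auto simp: meromorphic_C_def)
  obtain r where r: "r > 0" "\<And>w. w \<in> poles f \<Longrightarrow> dist w z < r \<Longrightarrow> w = z"
    using nolim unfolding islimpt_approachable by (metis dist_commute)
  show "finite_holo_at f z \<or> finite_holo_at (recip f) z"
  proof (cases "z \<in> poles f")
    case False
    hence "ball z r \<subseteq> - poles f" using r(2) by (metis ComplI dist_commute mem_ball subsetI)
    hence "finite_holo_at f z"
      unfolding finite_holo_at_def using r(1) hol holomorphic_on_subset
      by (intro exI[of _ r]) (auto simp: poles_def)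
    thus ?thesis ..
  next
    case True
    let ?u = "\<lambda>w. the (recip f w)"
    have lim: "filterlim (\<lambda>z. the (f z)) at_infinity (at z)"
      using assms True by (auto simp: meromorphic_C_def intro: filterlim_norm_at_top_imp_at_infinity)
    hence "eventually (\<lambda>w. the (f w) \<noteq> 0) (at z)"
      by (rule filterlim_at_infinity_imp_eventually_ne)
    then obtain e where e: "e > 0" "\<And>w. w \<noteq> z \<Longrightarrow> dist w z < e \<Longrightarrow> the (f w) \<noteq> 0"
      by (auto simp: eventually_at)
    let ?s = "min r e"
    have u: "?u w = inverse (the (f w))" "recip f w \<noteq> None" if "w \<noteq> z" "dist w z < ?s" for w
      using that e(2)[of w] r(2)[of w]
      by (auto simp: recip_def poles_def inverse_eq_divide split: option.splits)
    have uz: "recip f z = Some 0" using True by (simp add: poles_def)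
    have "?u holomorphic_on ball z ?s"
    proof (rule no_isolated_singularity'[of "{z}"])
      fix w assume "w \<in> {z}"
      have "((\<lambda>w. inverse (the (f w))) \<longlongrightarrow> 0) (at z)"
        using lim by (rule tendsto_inverse_0[THEN filterlim_compose])
      moreover have "eventually (\<lambda>w. inverse (the (f w)) = ?u w) (at z)"
        unfolding eventually_at using r(1) e(1) u(1) by (intro exI[of _ ?s]) auto
      ultimately have "(?u \<longlongrightarrow> 0) (at z)" by (rule Lim_transform_eventually)
      thus "(?u \<longlongrightarrow> ?u w) (at w within ball z ?s)"
        using \<open>w \<in> {z}\<close> uz by (metis option.sel singletonD subset_UNIV tendsto_within_subset)
    next
      have "(\<lambda>w. inverse (the (f w))) holomorphic_on (ball z ?s - {z})"
      proof (intro holomorphic_intros)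
        show "(\<lambda>w. the (f w)) holomorphic_on (ball z ?s - {z})"
          by (rule holomorphic_on_subset[OF hol]) (use r(2) in \<open>auto simp: dist_commute\<close>)
      qed (use e(2) in \<open>auto simp: dist_commute\<close>)
      thus "?u holomorphic_on (ball z ?s - {z})"
        by (rule holomorphic_transform) (use u(1) in \<open>auto simp: dist_commute\<close>)
    qed auto
    moreover have "recip f w \<noteq> None" if "w \<in> ball z ?s" for w
      using u(2)[of w] uz that by (cases "w = z") (auto simp: dist_commute)
    ultimately have "finite_holo_at (recip f) z"
      unfolding finite_holo_at_def using r(1) e(1) by (intro exI[of _ ?s]) auto
    thus ?thesis ..
  qed
qed

section \<open>Completeness, and the theorems of Weierstrass and Hurwitz for spherical
  convergence\<close>

section \<open>Locally uniform limits in the spherical metric\<close>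

definition sphere_limit :: "(nat \<Rightarrow> complex \<Rightarrow> complex option) \<Rightarrow> (complex \<Rightarrow> complex option) \<Rightarrow> bool" where
  "sphere_limit F g \<longleftrightarrow> (\<forall>K. compact K \<longrightarrow>
     uniform_limit K (\<lambda>n z. stereo (F n z)) (\<lambda>z. stereo (g z)) sequentially)"

lemma sphere_limitD:
  assumes "sphere_limit F g" "compact K" "\<epsilon> > 0"
  shows "eventually (\<lambda>n. \<forall>z\<in>K. rho_S (F n z) (g z) < \<epsilon>) sequentially"
  using assms unfolding sphere_limit_def uniform_limit_iff rho_S_eq_dist by blast

lemma sphere_limit_recip:
  assumes "sphere_limit F g" shows "sphere_limit (\<lambda>n. recip (F n)) (recip g)"
  unfolding sphere_limit_def uniform_limit_iff rho_S_eq_dist[symmetric]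
  using sphere_limitD[OF assms] by simp

lemma sphere_limit_tendsto:
  assumes "sphere_limit F g"
  shows "(\<lambda>n. stereo (F n z)) \<longlonglongrightarrow> stereo (g z)"
  using assms[unfolded sphere_limit_def, rule_format, of "{z}"] by simp

lemma sphere_limit_continuous:
  assumes "sphere_limit F g" "\<And>n. sphere_holo (F n)"
  shows "continuous_on UNIV (\<lambda>z. stereo (g z))"
proof (rule continuous_at_imp_continuous_on, intro ballI)
  fix z
  have "continuous_on (cball z 1) (\<lambda>z. stereo (g z))"
    by (rule uniform_limit_theorem[where f = "\<lambda>n z. stereo (F n z)" and F = sequentially])
      (use assms continuous_on_stereo in \<open>auto simp: sphere_limit_def\<close>)
  thus "isCont (\<lambda>z. stereo (g z)) z"
    by (rule continuous_on_interior) simp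
qed

text \<open>Pointwise limits exist by completeness and stay on the closed sphere. Letting the second
  index tend to infinity in the Cauchy estimate for \<open>e / 2\<close> gives a uniform bound
  \<open>\<le> e / 2\<close>, hence \<open>< e\<close>.\<close>

lemma sphere_Cauchy_limit:
  assumes "\<And>K \<epsilon>. compact K \<Longrightarrow> \<epsilon> > 0 \<Longrightarrow> \<exists>N. \<forall>m\<ge>N. \<forall>n\<ge>N. \<forall>z\<in>K. rho_S (F n z) (F m z) < \<epsilon>"
  shows "\<exists>g. sphere_limit F g"
proof -
  have "\<exists>u. (\<lambda>n. stereo (F n z)) \<longlonglongrightarrow> stereo u" for z :: complex
  proof -
    have "Cauchy (\<lambda>n. stereo (F n z))"
      unfolding Cauchy_def using assms[of "{z}"] by (simp add: rho_S_eq_dist) (metis dist_commute)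
    then obtain p where p: "(\<lambda>n. stereo (F n z)) \<longlonglongrightarrow> p"
      by (auto simp: Cauchy_convergent_iff convergent_def)
    have "p \<in> sphere 0 1"
      by (rule closed_sequentially[OF closed_sphere _ p]) simp
    thus ?thesis using p by (metis range_stereo imageE)
  qed
  then obtain g where g: "\<And>z. (\<lambda>n. stereo (F n z)) \<longlonglongrightarrow> stereo (g z)" by metis
  have "sphere_limit F g"
    unfolding sphere_limit_def uniform_limit_iff
  proof (intro allI impI)
    fix K :: "complex set" and e :: real assume "compact K" "e > 0"
    then obtain N where N: "\<And>m n z. m \<ge> N \<Longrightarrow> n \<ge> N \<Longrightarrow> z \<in> K \<Longrightarrow> rho_S (F n z) (F m z) < e / 2"
      using assms[of K "e / 2"] half_gt_zero by meson
    have "dist (stereo (F n z)) (stereo (g z)) < e" if "n \<ge> N" "z \<in> K" for n z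
    proof -
      have "dist (stereo (F n z)) (stereo (g z)) \<le> e / 2"
      proof (rule tendsto_upperbound)
        show "(\<lambda>m. dist (stereo (F n z)) (stereo (F m z))) \<longlonglongrightarrow> dist (stereo (F n z)) (stereo (g z))"
          by (intro tendsto_intros g)
        show "eventually (\<lambda>m. dist (stereo (F n z)) (stereo (F m z)) \<le> e / 2) sequentially"
          using N that by (auto simp: eventually_sequentially rho_S_eq_dist intro!: exI[of _ N] less_imp_le)
      qed simp
      thus ?thesis using \<open>e > 0\<close> by simp
    qed
    thus "eventually (\<lambda>n. \<forall>z\<in>K. dist (stereo (F n z)) (stereo (g z)) < e) sequentially"
      by (auto simp: eventually_sequentially)
  qed
  thus ?thesis by blast
qed

text \<open>Near a point where the limit is finite, all late images lie in a compact part of the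
  sphere away from the north pole. There \<open>stereo_inv\<close> is uniformly continuous, so
  spherical convergence becomes ordinary uniform convergence, and Weierstrass' theorem makes the
  limit holomorphic.\<close>

lemma sphere_limit_local:
  assumes lim: "sphere_limit F g" and holo: "\<And>n. sphere_holo (F n)"
    and "g z \<noteq> None" "\<delta> > 0"
  obtains e N where "0 < e" "e < \<delta>" "\<And>w. w \<in> cball z e \<Longrightarrow> g w \<noteq> None"
    "\<And>n w. n \<ge> N \<Longrightarrow> w \<in> cball z e \<Longrightarrow> F n w \<noteq> None"
    "uniform_limit (cball z e) (\<lambda>n w. the (F n w)) (\<lambda>w. the (g w)) sequentially"
    "(\<lambda>w. the (g w)) holomorphic_on ball z e"
proof -
  \<comment> \<open>The gap below the north pole is cut into thirds: height
    \<open>1 - 3 * \<eta>\<close> for \<open>g\<close> at \<open>z\<close>, at most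
    \<open>1 - 2 * \<eta>\<close> for \<open>g\<close> on the disc, at most
    \<open>1 - \<eta>\<close> for late \<open>F n\<close>.\<close>
  define \<eta> where "\<eta> = (1 - snd (stereo (g z))) / 3"
  have \<eta>: "\<eta> > 0" using assms(3) snd_stereo_less_iff[of "g z"] by (simp add: \<eta>_def)
  have "isCont (\<lambda>w. snd (stereo (g w))) z"
    using sphere_limit_continuous[OF lim holo] by (intro continuous_intros)
      (simp add: continuous_on_eq_continuous_at)
  then obtain d where d: "d > 0" "\<And>w. dist w z < d \<Longrightarrow> dist (snd (stereo (g w))) (snd (stereo (g z))) < \<eta>"
    using \<eta> unfolding continuous_at_eps_delta by blast
  define e where "e = min d \<delta> / 2"
  have e: "0 < e" "e < d" "e < \<delta>" using d(1) assms(4) by (auto simp: e_def)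
  let ?U = "{p :: complex \<times> real. norm p = 1 \<and> snd p \<le> 1 - \<eta>}"
  have z: "snd (stereo (g z)) = 1 - 3 * \<eta>" by (simp add: \<eta>_def field_simps)
  have g: "snd (stereo (g w)) \<le> 1 - 2 * \<eta>" if "w \<in> cball z e" for w
    using d(2)[of w] that e(2) by (auto simp: dist_commute dist_real_def z)
  have gfin: "g w \<noteq> None" if "w \<in> cball z e" for w
    using g[OF that] \<eta> snd_stereo_less_iff[of "g w"] by linarith
  have ul: "uniform_limit (cball z e) (\<lambda>n w. stereo (F n w)) (\<lambda>w. stereo (g w)) sequentially"
    using lim by (simp add: sphere_limit_def)
  have "eventually (\<lambda>n. \<forall>w\<in>cball z e. dist (stereo (F n w)) (stereo (g w)) < \<eta>) sequentially"
    using ul \<eta> by (simp add: uniform_limit_iff)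
  then obtain N where N: "\<And>n w. n \<ge> N \<Longrightarrow> w \<in> cball z e \<Longrightarrow> dist (stereo (F n w)) (stereo (g w)) < \<eta>"
    unfolding eventually_sequentially by blast
  have F: "snd (stereo (F n w)) \<le> 1 - \<eta>" if "n \<ge> N" "w \<in> cball z e" for n w
    using N[OF that] g[OF that(2)] dist_snd_le[of "stereo (F n w)" "stereo (g w)"]
    by (simp add: dist_real_def)
  have Ffin: "F n w \<noteq> None" if "n \<ge> N" "w \<in> cball z e" for n w
    using F[OF that] \<eta> snd_stereo_less_iff[of "F n w"] by linarith
  have "compact ?U"
  proof -
    have "?U = sphere 0 1 \<inter> snd -` {..1 - \<eta>}" by auto
    moreover have "closed (snd -` {..1 - \<eta>} :: (complex \<times> real) set)"
      by (intro closed_vimage closed_atMost continuous_intros)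
    ultimately show ?thesis by (simp add: compact_Int_closed)
  qed
  moreover have "continuous_on ?U stereo_inv"
    unfolding stereo_inv_def using \<eta> by (intro continuous_intros) (auto simp flip: of_real_diff)
  ultimately have uc: "uniformly_continuous_on ?U stereo_inv"
    by (rule compact_uniformly_continuous[rotated])
  have "uniform_limit (cball z e) (\<lambda>n w. stereo_inv (stereo (F n w))) (stereo_inv \<circ> (\<lambda>w. stereo (g w))) sequentially"
  proof (rule uniform_limit_compose[OF ul uc])
    show "eventually (\<lambda>n. (\<lambda>w. stereo (F n w)) ` cball z e \<subseteq> ?U) sequentially"
      unfolding eventually_sequentially using F by (intro exI[of _ N]) auto
    show "(\<lambda>w. stereo (g w)) ` cball z e \<subseteq> ?U"
      using g \<eta> by fastforce
  qed
  moreover have "eventually (\<lambda>n. \<forall>w\<in>cball z e. stereo_inv (stereo (F n w)) = the (F n w)) sequentially"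
    unfolding eventually_sequentially using Ffin stereo_inv_stereo by blast
  ultimately have ul': "uniform_limit (cball z e) (\<lambda>n w. the (F n w)) (\<lambda>w. the (g w)) sequentially"
    by (rule uniform_limit_cong[THEN iffD1, rotated 2])
      (use gfin stereo_inv_stereo in auto)
  \<comment> \<open>Shifting the index by \<open>N\<close> makes every member of the sequence finite
    on the disc, as the convergence theorem asks of all members.\<close>
  have ul'': "uniform_limit (cball z e) (\<lambda>n w. the (F (n + N) w)) (\<lambda>w. the (g w)) sequentially"
    using ul' by (rule filterlim_compose[OF _ filterlim_add_const_nat_at_top])
  have "(\<lambda>w. the (g w)) holomorphic_on ball z e"
  proof (rule holomorphic_uniform_sequence[OF open_ball])
    show "(\<lambda>w. the (F (n + N) w)) holomorphic_on ball z e" for n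
      by (rule sphere_holo_imp_holomorphic_on[OF holo]) (use Ffin in auto)
    fix x assume "x \<in> ball z e"
    then obtain d where d: "d > 0" "cball x d \<subseteq> ball z e"
      using open_contains_cball open_ball by metis
    thus "\<exists>d>0. cball x d \<subseteq> ball z e \<and>
      uniform_limit (cball x d) (\<lambda>n w. the (F (n + N) w)) (\<lambda>w. the (g w)) sequentially"
      using uniform_limit_on_subset[OF ul''] ball_subset_cball by (meson order_trans)
  qed
  thus thesis using that[of e N] e gfin Ffin ul' by blast
qed

lemma sphere_limit_sphere_holo:
  assumes "sphere_limit F g" "\<And>n. sphere_holo (F n)"
  shows "sphere_holo g"
proof -
  have *: "finite_holo_at g z"
    if lim: "sphere_limit F g" and holo: "\<And>n. sphere_holo (F n)" and gz: "g z \<noteq> None" for F g z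
  proof -
    obtain e N where "0 < e" "\<And>w. w \<in> cball z e \<Longrightarrow> g w \<noteq> None" "(\<lambda>w. the (g w)) holomorphic_on ball z e"
      by (rule sphere_limit_local[OF lim holo gz zero_less_one]) (rule that)
    thus ?thesis unfolding finite_holo_at_def by (intro exI[of _ e]) auto
  qed
  show ?thesis
    unfolding sphere_holo_def
  proof
    fix z
    show "finite_holo_at g z \<or> finite_holo_at (recip g) z"
    proof (cases "g z = None")
      case True
      hence "finite_holo_at (recip g) z"
        by (intro *[OF sphere_limit_recip[OF assms(1)]] sphere_holo_recip assms(2)) simp
      thus ?thesis ..
    next
      case False
      thus ?thesis using *[OF assms] by blast
    qed
  qed
qed

text \<open>Hurwitz's theorem, applied on a disc where limit and late functions are finite. Its
  requirement that the limit be nonconstant there is supplied by \<open>nconst\<close>.\<close>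

lemma sphere_limit_zero_free:
  assumes lim: "sphere_limit F g" and holo: "\<And>n. sphere_holo (F n)"
    and nconst: "\<And>S c. open S \<Longrightarrow> S \<noteq> {} \<Longrightarrow> \<exists>z\<in>S. g z \<noteq> c"
    and "\<delta> > 0"
    and nz: "\<And>n w. w \<in> ball z \<delta> \<Longrightarrow> F n w \<noteq> Some 0"
  shows "g z \<noteq> Some 0"
proof
  assume gz: "g z = Some 0"
  obtain e N where e: "0 < e" "e < \<delta>" "\<And>w. w \<in> cball z e \<Longrightarrow> g w \<noteq> None"
    "\<And>n w. n \<ge> N \<Longrightarrow> w \<in> cball z e \<Longrightarrow> F n w \<noteq> None"
    "uniform_limit (cball z e) (\<lambda>n w. the (F n w)) (\<lambda>w. the (g w)) sequentially"
    "(\<lambda>w. the (g w)) holomorphic_on ball z e"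
    by (rule sphere_limit_local[OF lim holo, of z \<delta>]) (use gz assms(4) in auto)
  have "the (g z) \<noteq> 0"
  proof (rule Hurwitz_no_zeros[of "ball z e" "\<lambda>n w. the (F (n + N) w)" "\<lambda>w. the (g w)"])
    show "(\<lambda>w. the (F (n + N) w)) holomorphic_on ball z e" for n
      by (rule sphere_holo_imp_holomorphic_on[OF holo]) (use e(4) in auto)
    show "the (F (n + N) w) \<noteq> 0" if "w \<in> ball z e" for n w
      using e(4)[of "n + N" w] nz[of w "n + N"] that e(2) by (cases "F (n + N) w") auto
    show "uniform_limit K (\<lambda>n w. the (F (n + N) w)) (\<lambda>w. the (g w)) sequentially"
      if "compact K" "K \<subseteq> ball z e" for K
    proof -
      have "uniform_limit K (\<lambda>n w. the (F n w)) (\<lambda>w. the (g w)) sequentially"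
        by (rule uniform_limit_on_subset[OF e(5)]) (use that in auto)
      thus ?thesis by (rule filterlim_compose[OF _ filterlim_add_const_nat_at_top])
    qed
    show "\<not> (\<lambda>w. the (g w)) constant_on ball z e"
    proof
      assume "(\<lambda>w. the (g w)) constant_on ball z e"
      then obtain c where c: "\<And>w. w \<in> ball z e \<Longrightarrow> the (g w) = c"
        by (auto simp: constant_on_def)
      have "g w = Some c" if "w \<in> ball z e" for w
        using c[OF that] e(3)[of w] that by auto
      thus False using nconst[of "ball z e" "Some c"] e(1) by auto
    qed
  qed (use e in auto)
  thus False using gz by simp
qed

section \<open>Limits of translates\<close>

section \<open>Normal functions\<close>

lemma normal_C_limit:
  fixes h :: "nat \<Rightarrow> complex"
  assumes "normal_C f"
  obtains r g where "strict_mono r" "sphere_limit (\<lambda>n z. f (z + h (r n))) g"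
proof -
  obtain r :: "nat \<Rightarrow> nat" where r: "strict_mono r" "\<And>K \<epsilon>. compact K \<Longrightarrow> \<epsilon> > 0 \<Longrightarrow>
      \<exists>N. \<forall>m\<ge>N. \<forall>n\<ge>N. \<forall>z\<in>K. rho_S (f (z + h (r n))) (f (z + h (r m))) < \<epsilon>"
    using assms unfolding normal_C_def by meson
  from sphere_Cauchy_limit[OF r(2)] r(1) that show ?thesis by blast
qed

text \<open>If a limit were constant on one open set, the identity theorem would make it constant
  everywhere, and the shifts \<open>h (r n)\<close> would contradict \<open>N1\<close>.\<close>

lemma N1_limit:
  fixes h :: "nat \<Rightarrow> complex"
  assumes "N1 f" "sphere_holo f"
  obtains r g where "strict_mono r" "sphere_limit (\<lambda>n z. f (z + h (r n))) g" "sphere_holo g"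
    "\<And>S c. open S \<Longrightarrow> S \<noteq> {} \<Longrightarrow> \<exists>z\<in>S. g z \<noteq> c"
proof -
  have "normal_C f" using assms(1) by (simp add: N1_def)
  then obtain r g where r: "strict_mono r" and g: "sphere_limit (\<lambda>n z. f (z + h (r n))) g"
    by (rule normal_C_limit)
  have holo: "sphere_holo g"
    using sphere_limit_sphere_holo[OF g] sphere_holo_translate[OF assms(2)] by blast
  have "\<exists>z\<in>S. g z \<noteq> c" if S: "open S" "S \<noteq> {}" for S c
  proof (rule ccontr)
    assume "\<not> ?thesis"
    hence gc: "g z = c" for z using sphere_holo_identity[OF holo S] by blast
    have "\<exists>(h :: nat \<Rightarrow> complex) c. \<forall>K. compact K \<longrightarrow> (\<forall>\<epsilon>>0. \<exists>N. \<forall>n\<ge>N. \<forall>z\<in>K. rho_S (f (z + h n)) c < \<epsilon>)"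
      using sphere_limitD[OF g] unfolding gc eventually_sequentially
      by (intro exI[of _ "\<lambda>n. h (r n)"] exI[of _ c]) blast
    thus False using assms(1) unfolding N1_def by blast
  qed
  with r g holo that show ?thesis by blast
qed

lemma normal_C_recip: "normal_C f \<Longrightarrow> normal_C (recip f)"
  unfolding normal_C_def by simp

text \<open>Inversion is an isometry, so a constant limit \<open>c\<close> for
  \<open>recip f\<close> is a constant limit \<open>recip_pt c\<close> for \<open>f\<close>.\<close>

lemma N1_recip:
  assumes "N1 f" shows "N1 (recip f)"
proof -
  have *: "rho_S (recip f z) c = rho_S (f z) (recip_pt c)" for z c
    using rho_S_recip[of f z "\<lambda>_. recip_pt c" 0]
    unfolding recip_pt_recip_pt .
  show ?thesis
    using assms normal_C_recip unfolding N1_def * by blast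
qed

section \<open>Necessity: bounds off the divisor, separation and relative density\<close>

section \<open>Consequences of membership in the class\<close>

text \<open>With all shifts equal to 0, a constant \<open>f\<close> would be its own constant
  limit.\<close>

lemma N1_nonconst:
  assumes "N1 f" "sphere_holo f" "open S" "S \<noteq> {}"
  shows "\<exists>z\<in>S. f z \<noteq> c"
proof (rule ccontr)
  assume "\<not> ?thesis"
  hence "f z = c" for z
    using sphere_holo_identity[OF assms(2-4)] by blast
  hence "\<exists>(h :: nat \<Rightarrow> complex) c. \<forall>K. compact K \<longrightarrow> (\<forall>\<epsilon>>0. \<exists>N. \<forall>n\<ge>N. \<forall>z\<in>K. rho_S (f (z + h n)) c < \<epsilon>)"
    by (intro exI[of _ "\<lambda>_. 0"] exI[of _ c]) (simp add: rho_S_eq_dist)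
  thus False
    using assms(1) by (simp add: N1_def)
qed

lemma eventually_inverse_Suc_subseq_less:
  assumes "strict_mono r" "e > 0"
  shows "eventually (\<lambda>n. inverse (real (Suc (r n))) < e) sequentially"
proof -
  have "(\<lambda>n. inverse (real (Suc (r n)))) \<longlonglongrightarrow> 0"
    using LIMSEQ_subseq_LIMSEQ[OF LIMSEQ_inverse_real_of_nat assms(1)] by (simp add: o_def)
  thus ?thesis
    by (rule order_tendstoD(2)) (use assms(2) in simp)
qed

text \<open>Otherwise translate to points \<open>h n\<close> where \<open>f\<close> is nearly 0
  although no zero is within \<open>\<delta>\<close>. The limit vanishes at 0, while all translates
  are zero-free on \<open>ball 0 \<delta>\<close>, against Hurwitz.\<close>

lemma N1_zero_lower_bound:
  assumes N1: "N1 f" and holo: "sphere_holo f" and "\<delta> > 0"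
  shows "\<exists>c>0. \<forall>z. (\<forall>a\<in>zeros f. z \<notin> ball a \<delta>) \<longrightarrow> c \<le> rho_S (f z) (Some 0)"
proof (rule ccontr)
  assume neg: "\<not> ?thesis"
  have "\<exists>z. (\<forall>a\<in>zeros f. z \<notin> ball a \<delta>) \<and> rho_S (f z) (Some 0) < inverse (real (Suc n))" for n
    using neg by (meson inverse_positive_iff_positive not_le of_nat_0_less_iff zero_less_Suc)
  then obtain h where h: "\<And>n a. a \<in> zeros f \<Longrightarrow> h n \<notin> ball a \<delta>"
      "\<And>n. rho_S (f (h n)) (Some 0) < inverse (real (Suc n))" by metis
  obtain r g where r: "strict_mono r" and lim: "sphere_limit (\<lambda>n z. f (z + h (r n))) g"
    and nconst: "\<And>S c. open S \<Longrightarrow> S \<noteq> {} \<Longrightarrow> \<exists>z\<in>S. g z \<noteq> c"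
    by (rule N1_limit[OF N1 holo, of h]) (rule that)
  have "g 0 \<noteq> Some 0"
  proof (rule sphere_limit_zero_free[OF lim sphere_holo_translate[OF holo] nconst \<open>\<delta> > 0\<close>])
    fix n and w :: complex assume w: "w \<in> ball 0 \<delta>"
    show "f (w + h (r n)) \<noteq> Some 0"
    proof
      assume "f (w + h (r n)) = Some 0"
      hence "h (r n) \<notin> ball (w + h (r n)) \<delta>" by (intro h(1)) (simp add: zeros_def)
      thus False using w by (simp add: dist_norm)
    qed
  qed
  moreover have "(\<lambda>n. stereo (f (h (r n)))) \<longlonglongrightarrow> stereo (Some 0)"
  proof (rule tendstoI)
    fix e :: real assume "e > 0"
    hence "eventually (\<lambda>n. inverse (real (Suc (r n))) < e) sequentially"
      by (rule eventually_inverse_Suc_subseq_less[OF r])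
    thus "eventually (\<lambda>n. dist (stereo (f (h (r n)))) (stereo (Some 0)) < e) sequentially"
      by eventually_elim (metis h(2) rho_S_eq_dist less_trans)
  qed
  moreover have "(\<lambda>n. stereo (f (h (r n)))) \<longlonglongrightarrow> stereo (g 0)"
    using sphere_limit_tendsto[OF lim, of 0] by simp
  ultimately show False
    using LIMSEQ_unique inj_stereo by blast
qed

lemma N1_bounds_off_divisor:
  assumes N1: "N1 f" and holo: "sphere_holo f" and "\<delta> > 0"
  shows "\<exists>C>0. \<forall>z. (\<forall>a\<in>zeros f. z \<notin> ball a \<delta>) \<and> (\<forall>b\<in>poles f. z \<notin> ball b \<delta>) \<longrightarrow>
    (\<exists>w. f z = Some w \<and> 1 / C \<le> cmod w \<and> cmod w \<le> C)"
proof -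
  obtain c where c: "c > 0" "\<And>z. \<forall>a\<in>zeros f. z \<notin> ball a \<delta> \<Longrightarrow> c \<le> rho_S (f z) (Some 0)"
    using N1_zero_lower_bound[OF N1 holo \<open>\<delta> > 0\<close>] by metis
  obtain c' where c': "c' > 0" "\<And>z. \<forall>b\<in>poles f. z \<notin> ball b \<delta> \<Longrightarrow> c' \<le> rho_S (recip f z) (Some 0)"
    using N1_zero_lower_bound[OF N1_recip[OF N1] sphere_holo_recip[OF holo] \<open>\<delta> > 0\<close>]
    unfolding zeros_recip by metis
  \<comment> \<open>The factor 2 comes from \<open>rho_S \<le> 2 * cmod (a - b)\<close>: distance at
    least \<open>c\<close> from 0 gives \<open>|f| \<ge> c / 2\<close>, and likewise
    \<open>|1/f| \<ge> c' / 2\<close>.\<close>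
  define C where "C = max (2 / c) (2 / c')"
  have C: "C > 0" using c(1) by (simp add: C_def less_max_iff_disj)
  have "\<exists>w. f z = Some w \<and> 1 / C \<le> cmod w \<and> cmod w \<le> C"
    if z: "\<forall>a\<in>zeros f. z \<notin> ball a \<delta>" "\<forall>b\<in>poles f. z \<notin> ball b \<delta>" for z
  proof -
    have "f z \<noteq> None" "f z \<noteq> Some 0"
      using z \<open>\<delta> > 0\<close> by (auto simp: poles_def zeros_def)
    then obtain w where w: "f z = Some w" "w \<noteq> 0" by auto
    have 1: "cmod w \<ge> c / 2"
      using c(2)[OF z(1)] w(1) by (intro rho_S_zero_le_imp) simp
    have "recip f z = Some (1 / w)" using w by (simp add: recip_def)
    hence 2: "cmod (1 / w) \<ge> c' / 2"
      using c'(2)[OF z(2)] by (intro rho_S_zero_le_imp) simp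
    have "1 / C \<le> c / 2"
      using c(1) C by (simp add: C_def field_simps le_max_iff_disj max_def)
    moreover have "cmod w \<le> 2 / c'"
      using 2 c'(1) w(2) by (simp add: norm_divide field_simps)
    ultimately show ?thesis using w(1) 1 by (auto simp: C_def)
  qed
  thus ?thesis using C by blast
qed

text \<open>Given bad pairs \<open>x n\<close>, \<open>y n\<close> with distance tending to 0,
  translate by \<open>x n\<close>. The limit is continuous at 0 and \<open>y n - x n\<close> tends
  to 0, so three errors below \<open>\<epsilon> / 3\<close> contradict the gap
  \<open>\<epsilon>\<close>.\<close>

lemma normal_C_uniformly_continuous:
  assumes "normal_C f" and holo: "sphere_holo f" and "\<epsilon> > 0"
  shows "\<exists>d>0. \<forall>z w. dist z w < d \<longrightarrow> rho_S (f z) (f w) < \<epsilon>"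
proof (rule ccontr)
  assume neg: "\<not> ?thesis"
  have "\<exists>z w. dist z w < inverse (real (Suc n)) \<and> rho_S (f z) (f w) \<ge> \<epsilon>" for n
    using neg by (meson inverse_positive_iff_positive not_le of_nat_0_less_iff zero_less_Suc)
  then obtain x y where xy: "\<And>n. dist (x n) (y n) < inverse (real (Suc n))"
      "\<And>n. rho_S (f (x n)) (f (y n)) \<ge> \<epsilon>" by metis
  obtain r g where r: "strict_mono r" and lim: "sphere_limit (\<lambda>n z. f (z + x (r n))) g"
    by (rule normal_C_limit[OF assms(1), of x])
  have "isCont (\<lambda>z. stereo (g z)) 0"
    using sphere_limit_continuous[OF lim sphere_holo_translate[OF holo]]
    by (simp add: continuous_on_eq_continuous_at)
  then obtain d where d: "d > 0" "\<And>w. dist w 0 < d \<Longrightarrow> dist (stereo (g w)) (stereo (g 0)) < \<epsilon> / 3"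
    using \<open>\<epsilon> > 0\<close> unfolding continuous_at_eps_delta by (meson divide_pos_pos zero_less_numeral)
  have "eventually (\<lambda>n. inverse (real (Suc (r n))) < min d 1) sequentially"
    by (rule eventually_inverse_Suc_subseq_less[OF r]) (use d(1) in simp)
  moreover have "eventually (\<lambda>n. \<forall>z\<in>cball 0 1. rho_S (f (z + x (r n))) (g z) < \<epsilon> / 3) sequentially"
    using sphere_limitD[OF lim, of "cball 0 1" "\<epsilon> / 3"] \<open>\<epsilon> > 0\<close> by simp
  ultimately have "eventually (\<lambda>n. False) sequentially"
  proof eventually_elim
    case (elim n)
    let ?w = "y (r n) - x (r n)"
    have w: "cmod ?w < d" "cmod ?w < 1"
      using xy(1)[of "r n"] elim(1) by (auto simp: dist_norm norm_minus_commute)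
    have "rho_S (f (0 + x (r n))) (g 0) < \<epsilon> / 3" "rho_S (f (?w + x (r n))) (g ?w) < \<epsilon> / 3"
      by (rule bspec[OF elim(2)], use w in simp)+
    moreover have "dist (stereo (g ?w)) (stereo (g 0)) < \<epsilon> / 3"
      using d(2)[of ?w] w by simp
    moreover have "dist (stereo (f (x (r n)))) (stereo (f (y (r n)))) \<ge> \<epsilon>"
      using xy(2)[of "r n"] by (simp add: rho_S_eq_dist)
    ultimately show False
      by (simp add: rho_S_eq_dist)
        (smt (verit) dist_commute dist_triangle field_sum_of_halves)
  qed
  thus False by simp
qed

text \<open>The values 0 and infinity are at spherical distance 2, so uniform continuity with
  \<open>\<epsilon> = 2\<close> provides the separation.\<close>

lemma zeros_poles_separated:
  assumes "normal_C f" "sphere_holo f"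
  shows "\<exists>d>0. \<forall>a\<in>zeros f. \<forall>b\<in>poles f. d \<le> cmod (a - b)"
proof -
  obtain d where "d > 0" and d: "\<And>z w. dist z w < d \<Longrightarrow> rho_S (f z) (f w) < 2"
    using normal_C_uniformly_continuous[OF assms, of 2] by auto
  moreover have "d \<le> cmod (a - b)" if "a \<in> zeros f" "b \<in> poles f" for a b
    using d[of a b] that rho_S_zero_infinity by (force simp: zeros_def poles_def dist_norm)
  ultimately show ?thesis by blast
qed

text \<open>Translating to the centres of ever larger zero-free discs gives a limit \<open>g\<close>
  that keeps distance \<open>c\<close> from 0 on the whole plane. Then \<open>1/g\<close> is a
  bounded entire function, constant by Liouville, which limits of translates cannot be.\<close>

lemma N1_zeros_relatively_dense:
  assumes N1: "N1 f" and holo: "sphere_holo f"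
  shows "\<exists>R. \<forall>w. \<exists>a\<in>zeros f. a \<in> ball w R"
proof (rule ccontr)
  assume "\<not> ?thesis"
  hence "\<forall>n::nat. \<exists>w. \<forall>a\<in>zeros f. a \<notin> ball w (real n)" by blast
  then obtain h where h: "\<And>n a. a \<in> zeros f \<Longrightarrow> a \<notin> ball (h n) (real n)" by metis
  obtain c where c: "c > 0" "\<And>z. \<forall>a\<in>zeros f. z \<notin> ball a 1 \<Longrightarrow> c \<le> rho_S (f z) (Some 0)"
    using N1_zero_lower_bound[OF N1 holo zero_less_one] by metis
  obtain r g where r: "strict_mono r" and lim: "sphere_limit (\<lambda>n z. f (z + h (r n))) g"
    and gholo: "sphere_holo g"
    and nconst: "\<And>S c. open S \<Longrightarrow> S \<noteq> {} \<Longrightarrow> \<exists>z\<in>S. g z \<noteq> c"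
    by (rule N1_limit[OF N1 holo, of h]) (rule that)
  have gc: "c \<le> rho_S (g z) (Some 0)" for z
  proof (rule tendsto_lowerbound)
    show "(\<lambda>n. rho_S (f (z + h (r n))) (Some 0)) \<longlonglongrightarrow> rho_S (g z) (Some 0)"
      unfolding rho_S_eq_dist by (intro tendsto_intros sphere_limit_tendsto[OF lim])
    \<comment> \<open>Since \<open>r n \<ge> n \<ge> |z| + 1\<close>, the unit disc around
      \<open>z + h (r n)\<close> lies inside the zero-free disc of radius
      \<open>r n\<close>.\<close>
    have "c \<le> rho_S (f (z + h (r n))) (Some 0)" if "real n \<ge> cmod z + 1" for n
    proof (rule c(2), intro ballI notI)
      fix a assume a: "a \<in> zeros f" "z + h (r n) \<in> ball a 1"
      have "dist (h (r n)) a \<le> dist (h (r n)) (z + h (r n)) + dist (z + h (r n)) a"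
        by (rule dist_triangle)
      also have "\<dots> < cmod z + 1" using a(2) by (simp add: dist_norm norm_minus_commute)
      also have "\<dots> \<le> real (r n)" using that seq_suble[OF r, of n] by linarith
      finally show False using h[OF a(1), of "r n"] by simp
    qed
    moreover obtain N :: nat where "cmod z + 1 \<le> real N" using real_arch_simple by blast
    ultimately show "eventually (\<lambda>n. c \<le> rho_S (f (z + h (r n))) (Some 0)) sequentially"
      by (intro eventually_sequentiallyI[of N]) (meson of_nat_le_iff order_trans)
  qed simp
  let ?u = "\<lambda>z. the (recip g z)"
  have fin: "recip g z \<noteq> None" for z
    using gc[of z] c(1) by (auto simp: rho_S_eq_dist)
  have "?u holomorphic_on UNIV"
    by (rule sphere_holo_imp_holomorphic_on[OF sphere_holo_recip[OF gholo] fin])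
  moreover have "bounded (range ?u)"
    unfolding bounded_iff
  proof (intro exI[of _ "2 / c"] ballI, elim rangeE)
    fix x z assume x: "x = ?u z"
    obtain v where v: "recip g z = Some v" using fin[of z] by (metis option.collapse)
    \<comment> \<open>Inversion turns the distance from 0 into the distance of
      \<open>v = 1/g\<close> from infinity, \<open>2 / sqrt (1 + |v|^2)\<close>; a lower bound for
      it bounds \<open>|v|\<close> by \<open>2 / c\<close>.\<close>
    have "rho_S (g z) (Some 0) = rho_S (recip g z) (recip (\<lambda>_. Some 0) 0)"
      by (simp only: rho_S_recip)
    also have "\<dots> = 2 / sqrt (1 + (cmod v)\<^sup>2)"
      unfolding v by (simp add: rho_S_def recip_def)
    finally have "c \<le> 2 / sqrt (1 + (cmod v)\<^sup>2)" using gc[of z] by simp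
    hence "sqrt (1 + (cmod v)\<^sup>2) \<le> 2 / c"
      using c(1) one_plus_norm_sq_pos[of v] by (simp add: field_simps)
    moreover have "cmod v \<le> sqrt (1 + (cmod v)\<^sup>2)" by (rule real_le_rsqrt) simp
    ultimately show "cmod x \<le> 2 / c" using x v by simp
  qed
  ultimately have "?u constant_on UNIV" by (rule Liouville_theorem)
  then obtain k where "\<And>z. ?u z = k" by (auto simp: constant_on_def)
  hence "recip g z = Some k" for z using fin[of z] by (metis option.collapse)
  hence "g z = recip_pt (Some k)" for z by (metis recip_eq recip_recip)
  thus False using nconst[of UNIV "recip_pt (Some k)"] by auto
qed

text \<open>If \<open>f\<close> were arbitrarily close to 0 on whole discs of radius
  \<open>\<delta>\<close>, translates to their centres would have a limit vanishing identically on
  \<open>ball 0 \<delta>\<close>. The point is that \<open>m\<close> does not depend on the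
  centre.\<close>

lemma N1_not_uniformly_small:
  assumes N1: "N1 f" and holo: "sphere_holo f" and "\<delta> > 0"
  shows "\<exists>m>0. \<forall>a. \<exists>b\<in>ball a \<delta>. m \<le> rho_S (f b) (Some 0)"
proof (rule ccontr)
  assume neg: "\<not> ?thesis"
  have "\<exists>a. \<forall>b\<in>ball a \<delta>. rho_S (f b) (Some 0) < inverse (real (Suc n))" for n
    using neg by (meson inverse_positive_iff_positive not_le of_nat_0_less_iff zero_less_Suc)
  then obtain h where h: "\<And>n b. b \<in> ball (h n) \<delta> \<Longrightarrow> rho_S (f b) (Some 0) < inverse (real (Suc n))"
    by metis
  obtain r g where r: "strict_mono r" and lim: "sphere_limit (\<lambda>n z. f (z + h (r n))) g"
    and nconst: "\<And>S c. open S \<Longrightarrow> S \<noteq> {} \<Longrightarrow> \<exists>z\<in>S. g z \<noteq> c"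
    by (rule N1_limit[OF N1 holo, of h]) (rule that)
  have "g z = Some 0" if z: "z \<in> ball 0 \<delta>" for z
  proof -
    have "(\<lambda>n. stereo (f (z + h (r n)))) \<longlonglongrightarrow> stereo (Some 0)"
    proof (rule tendstoI)
      fix e :: real assume "e > 0"
      hence "eventually (\<lambda>n. inverse (real (Suc (r n))) < e) sequentially"
        by (rule eventually_inverse_Suc_subseq_less[OF r])
      thus "eventually (\<lambda>n. dist (stereo (f (z + h (r n)))) (stereo (Some 0)) < e) sequentially"
      proof eventually_elim
        case (elim n)
        have "z + h (r n) \<in> ball (h (r n)) \<delta>" using z by (simp add: dist_norm)
        from h[OF this] elim show ?case unfolding rho_S_eq_dist by linarith
      qed
    qed
    thus ?thesis
      using sphere_limit_tendsto[OF lim, of z] LIMSEQ_unique inj_stereo by blast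
  qed
  thus False using nconst[of "ball 0 \<delta>" "Some 0"] \<open>\<delta> > 0\<close> by auto
qed

section \<open>Dividing out zeros, and the bound for their number in unit discs\<close>

section \<open>Counting zeros with multiplicity\<close>

text \<open>Some derivative at \<open>a\<close> is nonzero, for otherwise the Taylor series would
  vanish on a disc. Hence the \<open>LEAST\<close>, phrased as in \<open>zero_mult\<close>, is
  attained and is the true order of the zero.\<close>

lemma holomorphic_factor_local:
  fixes \<phi> :: "complex \<Rightarrow> complex"
  assumes "\<phi> holomorphic_on S" "open S" "a \<in> S" "\<phi> a = 0"
    and nz: "\<And>r. r > 0 \<Longrightarrow> \<exists>w\<in>ball a r. \<phi> w \<noteq> 0"
  defines "n \<equiv> (LEAST n. (deriv ^^ n) \<phi> a \<noteq> 0)"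
  shows "n > 0" "\<exists>g e. e > 0 \<and> g holomorphic_on ball a e \<and> (\<forall>w\<in>ball a e. \<phi> w = (w - a) ^ n * g w)"
proof -
  obtain r where r: "r > 0" "ball a r \<subseteq> S" using assms(2,3) openE by blast
  have "\<exists>n. (deriv ^^ n) \<phi> a \<noteq> 0"
    using holomorphic_fun_eq_0_on_ball[OF holomorphic_on_subset[OF assms(1) r(2)]] nz[OF r(1)] by blast
  hence n: "(deriv ^^ n) \<phi> a \<noteq> 0" unfolding n_def by (rule LeastI_ex)
  thus "n > 0" using assms(4) by (cases n) auto
  have "(deriv ^^ i) \<phi> a = 0" if "i < n" for i
    using not_less_Least[of i "\<lambda>n. (deriv ^^ n) \<phi> a \<noteq> 0"] that by (simp add: n_def)
  then obtain g e where "0 < e" "g holomorphic_on ball a e" "\<And>w. w \<in> ball a e \<Longrightarrow> \<phi> w - \<phi> a = (w - a) ^ n * g w"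
    using holomorphic_factor_order_of_zero[OF assms(1-3) \<open>n > 0\<close> n] by metis
  thus "\<exists>g e. e > 0 \<and> g holomorphic_on ball a e \<and> (\<forall>w\<in>ball a e. \<phi> w = (w - a) ^ n * g w)"
    using assms(4) by (intro exI[of _ g] exI[of _ e]) simp
qed

text \<open>The quotient is holomorphic off \<open>a\<close> and agrees with \<open>g\<close> near
  \<open>a\<close> once \<open>g a\<close> is put in as its value there; the two open pieces are
  then glued.\<close>

lemma holomorphic_divide_factor:
  fixes \<phi> :: "complex \<Rightarrow> complex"
  assumes "\<phi> holomorphic_on S" "open S" "e > 0" "g holomorphic_on ball a e"
    and eq: "\<And>w. w \<in> ball a e \<Longrightarrow> \<phi> w = (w - a) ^ n * g w"
  shows "\<exists>\<psi>. \<psi> holomorphic_on S \<and> (\<forall>w\<in>S. \<phi> w = (w - a) ^ n * \<psi> w)"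
proof -
  define \<psi> where "\<psi> w = (if w = a then g a else \<phi> w / (w - a) ^ n)" for w
  have "(\<lambda>w. \<phi> w / (w - a) ^ n) holomorphic_on (S - {a})"
    by (intro holomorphic_intros holomorphic_on_subset[OF assms(1)]) auto
  hence "\<psi> holomorphic_on (S - {a})"
    by (rule holomorphic_transform) (simp add: \<psi>_def)
  moreover have "\<psi> holomorphic_on ball a e"
    by (rule holomorphic_transform[OF assms(4)]) (use eq in \<open>simp add: \<psi>_def\<close>)
  ultimately have "\<psi> holomorphic_on ((S - {a}) \<union> ball a e)"
    using assms(2) by (intro holomorphic_on_Un) auto
  hence "\<psi> holomorphic_on S"
    by (rule holomorphic_on_subset) (use assms(3) in auto)
  moreover have "\<phi> w = (w - a) ^ n * \<psi> w" for w
    using eq[of a] assms(3) by (auto simp: \<psi>_def)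
  ultimately show ?thesis by blast
qed

text \<open>Induction on \<open>Z\<close>: after the factor at \<open>a\<close> is removed, the
  other points keep their local factorisations, since \<open>(w - a) ^ n a\<close> has no zero near
  them.\<close>

lemma holomorphic_divide_factors:
  fixes \<phi> :: "complex \<Rightarrow> complex"
  assumes "finite Z" "\<phi> holomorphic_on S" "open S" "Z \<subseteq> S"
    and "\<And>z. z \<in> Z \<Longrightarrow> \<exists>g e. e > 0 \<and> g holomorphic_on ball z e \<and> (\<forall>w\<in>ball z e. \<phi> w = (w - z) ^ n z * g w)"
  shows "\<exists>\<psi>. \<psi> holomorphic_on S \<and> (\<forall>w\<in>S. \<phi> w = (\<Prod>z\<in>Z. (w - z) ^ n z) * \<psi> w)"
  using assms(1,2,4,5)
proof (induction Z arbitrary: \<phi> rule: finite_induct)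
  case empty
  thus ?case by auto
next
  case (insert a Z)
  obtain g e where "e > 0" "g holomorphic_on ball a e" "\<And>w. w \<in> ball a e \<Longrightarrow> \<phi> w = (w - a) ^ n a * g w"
    using insert.prems(3)[of a] by blast
  from holomorphic_divide_factor[OF insert.prems(1) assms(3) this]
  obtain \<psi> where \<psi>: "\<psi> holomorphic_on S" "\<And>w. w \<in> S \<Longrightarrow> \<phi> w = (w - a) ^ n a * \<psi> w" by blast
  have "\<exists>\<psi>'. \<psi>' holomorphic_on S \<and> (\<forall>w\<in>S. \<psi> w = (\<Prod>z\<in>Z. (w - z) ^ n z) * \<psi>' w)"
  proof (rule insert.IH[OF \<psi>(1)])
    fix z assume z: "z \<in> Z"
    obtain g e where g: "e > 0" "g holomorphic_on ball z e" "\<And>w. w \<in> ball z e \<Longrightarrow> \<phi> w = (w - z) ^ n z * g w"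
      using insert.prems(3)[of z] z by blast
    obtain s where s: "s > 0" "ball z s \<subseteq> S"
      using openE[OF assms(3), of z] insert.prems(2) z by blast
    \<comment> \<open>Small enough to keep \<open>a\<close> outside the ball while staying within
      \<open>S\<close> and within the domain of the old factor \<open>g\<close>.\<close>
    define d where "d = min (dist z a) (min e s)"
    have d: "d > 0" using g(1) s(1) z insert.hyps(2) by (auto simp: d_def)
    have na: "w \<noteq> a" if "w \<in> ball z d" for w using that by (auto simp: d_def)
    have "(\<lambda>w. g w / (w - a) ^ n a) holomorphic_on ball z d"
      by (intro holomorphic_intros holomorphic_on_subset[OF g(2)]) (use na in \<open>auto simp: d_def\<close>)
    moreover have "\<psi> w = (w - z) ^ n z * (g w / (w - a) ^ n a)" if "w \<in> ball z d" for w
    proof -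
      have "w \<in> S" "w \<in> ball z e" using that s(2) by (auto simp: d_def)
      thus ?thesis using g(3)[of w] \<psi>(2)[of w] na[OF that] by (simp add: field_simps)
    qed
    ultimately show "\<exists>g e. e > 0 \<and> g holomorphic_on ball z e \<and> (\<forall>w\<in>ball z e. \<psi> w = (w - z) ^ n z * g w)"
      using d by blast
  qed (use insert.prems(2) in blast)
  then obtain \<psi>' where \<psi>': "\<psi>' holomorphic_on S" "\<And>w. w \<in> S \<Longrightarrow> \<psi> w = (\<Prod>z\<in>Z. (w - z) ^ n z) * \<psi>' w" by blast
  have "\<phi> w = (\<Prod>z\<in>insert a Z. (w - z) ^ n z) * \<psi>' w" if "w \<in> S" for w
    using \<psi>(2)[OF that] \<psi>'(2)[OF that] insert.hyps by (simp add: mult.assoc)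
  thus ?case using \<psi>'(1) by blast
qed

text \<open>Divide out the zeros and apply the maximum modulus principle to the quotient on the
  circle of radius \<open>5 * r\<close>: there each factor is at least \<open>4 * r\<close>, at \<open>b\<close> it is at most \<open>2 * r\<close>.\<close>

lemma zero_count_bound:
  fixes \<phi> :: "complex \<Rightarrow> complex"
  assumes "finite Z" "Z \<subseteq> cball p r" "r > 0" "5 * r < R" "\<phi> holomorphic_on ball p R"
    and bd: "\<And>w. w \<in> ball p R \<Longrightarrow> cmod (\<phi> w) \<le> 1"
    and loc: "\<And>z. z \<in> Z \<Longrightarrow> \<exists>g e. e > 0 \<and> g holomorphic_on ball z e \<and> (\<forall>w\<in>ball z e. \<phi> w = (w - z) ^ n z * g w)"
    and b: "b \<in> cball p r"
  shows "cmod (\<phi> b) \<le> (1/2) ^ (\<Sum>z\<in>Z. n z)"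
proof -
  let ?N = "\<Sum>z\<in>Z. n z"
  have sub: "cball p r \<subseteq> ball p R" "cball p (5 * r) \<subseteq> ball p R"
    using assms(3,4) by auto
  obtain \<psi> where \<psi>: "\<psi> holomorphic_on ball p R"
      "\<And>w. w \<in> ball p R \<Longrightarrow> \<phi> w = (\<Prod>z\<in>Z. (w - z) ^ n z) * \<psi> w"
    using holomorphic_divide_factors[OF assms(1,5) open_ball _ loc] assms(2) sub by blast
  have "cmod (\<psi> b) \<le> 1 / (4 * r) ^ ?N"
  proof (rule maximum_modulus_frontier[of \<psi> "cball p (5 * r)"])
    show "\<psi> holomorphic_on interior (cball p (5 * r))"
      using \<psi>(1) sub(2) by (meson holomorphic_on_subset interior_subset order_trans)
    show "continuous_on (closure (cball p (5 * r))) \<psi>"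
      using holomorphic_on_imp_continuous_on[OF \<psi>(1)] sub(2) by (auto intro: continuous_on_subset)
    show "b \<in> cball p (5 * r)" using b assms(3) by auto
    fix w assume "w \<in> frontier (cball p (5 * r))"
    hence w: "dist p w = 5 * r" using assms(3) by (simp add: frontier_cball)
    hence wR: "w \<in> ball p R" using assms(4) by simp
    have "(4 * r) ^ ?N = (\<Prod>z\<in>Z. (4 * r) ^ n z)" by (simp add: power_sum)
    also have "\<dots> \<le> (\<Prod>z\<in>Z. cmod (w - z) ^ n z)"
    proof (intro prod_mono conjI power_mono)
      fix z assume "z \<in> Z"
      hence "dist p z \<le> r" using assms(2) by auto
      hence "dist w z \<ge> 4 * r" using w dist_triangle[of p w z] by (simp add: dist_commute)
      thus "4 * r \<le> cmod (w - z)" by (simp add: dist_norm)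
    qed (use assms(3) in auto)
    also have "\<dots> = cmod (\<Prod>z\<in>Z. (w - z) ^ n z)" by (simp add: norm_power flip: prod_norm)
    finally have "(4 * r) ^ ?N * cmod (\<psi> w) \<le> cmod (\<Prod>z\<in>Z. (w - z) ^ n z) * cmod (\<psi> w)"
      by (rule mult_right_mono) simp
    also have "\<dots> = cmod (\<phi> w)" using \<psi>(2)[OF wR] by (simp add: norm_mult)
    also have "\<dots> \<le> 1" by (rule bd[OF wR])
    finally show "cmod (\<psi> w) \<le> 1 / (4 * r) ^ ?N"
      using assms(3) by (simp add: field_simps)
  qed simp
  moreover have "cmod (\<Prod>z\<in>Z. (b - z) ^ n z) \<le> (2 * r) ^ ?N"
  proof -
    have "cmod (\<Prod>z\<in>Z. (b - z) ^ n z) = (\<Prod>z\<in>Z. cmod (b - z) ^ n z)"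
      by (simp add: norm_power flip: prod_norm)
    also have "\<dots> \<le> (\<Prod>z\<in>Z. (2 * r) ^ n z)"
    proof (intro prod_mono conjI power_mono)
      fix z assume "z \<in> Z"
      hence "dist p z \<le> r" using assms(2) by auto
      hence "dist b z \<le> 2 * r" using b dist_triangle[of b z p] by (simp add: dist_commute)
      thus "cmod (b - z) \<le> 2 * r" by (simp add: dist_norm)
    qed auto
    also have "\<dots> = (2 * r) ^ ?N" by (simp add: power_sum)
    finally show ?thesis .
  qed
  ultimately have "cmod (\<Prod>z\<in>Z. (b - z) ^ n z) * cmod (\<psi> b) \<le> (2 * r) ^ ?N * (1 / (4 * r) ^ ?N)"
    using assms(3) by (intro mult_mono) auto
  also have "\<dots> = ((2 * r) / (4 * r)) ^ ?N" unfolding power_divide by simp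
  also have "(2 * r) / (4 * r) = 1 / 2" using assms(3) by simp
  finally show ?thesis
    using \<psi>(2)[of b] b sub(1) by (auto simp: norm_mult)
qed

lemma sum_le_sum_cover:
  fixes n :: "'a \<Rightarrow> nat"
  assumes "finite K" "finite Z" "Z \<subseteq> (\<Union>k\<in>K. A k)"
  shows "(\<Sum>z\<in>Z. n z) \<le> (\<Sum>k\<in>K. \<Sum>z\<in>Z \<inter> A k. n z)"
proof -
  have "(\<Sum>z\<in>Z. n z) \<le> (\<Sum>z\<in>Z. \<Sum>k\<in>K. if z \<in> A k then n z else 0)"
  proof (rule sum_mono)
    fix z assume "z \<in> Z"
    then obtain k where "k \<in> K" "z \<in> A k" using assms(3) by blast
    thus "n z \<le> (\<Sum>k\<in>K. if z \<in> A k then n z else 0)"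
      using member_le_sum[of k K "\<lambda>k. if z \<in> A k then n z else 0"] assms(1) by simp
  qed
  also have "\<dots> = (\<Sum>k\<in>K. \<Sum>z\<in>Z. if z \<in> A k then n z else 0)" by (rule sum.swap)
  also have "\<dots> = (\<Sum>k\<in>K. \<Sum>z\<in>Z \<inter> A k. n z)"
    using assms(2) by (simp add: sum.inter_restrict)
  finally show ?thesis .
qed

text \<open>The hypothesis \<open>nconst\<close> excludes a function vanishing near
  \<open>z\<close>, for which the \<open>LEAST\<close> in \<open>zero_mult\<close> would be taken
  over no candidates.\<close>

lemma zero_mult_factor:
  assumes holo: "sphere_holo f" and fz: "f z = Some 0"
    and nconst: "\<And>e. e > 0 \<Longrightarrow> \<exists>w\<in>ball z e. f w \<noteq> Some 0"
  shows "zero_mult f z > 0"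
    "\<exists>g e. e > 0 \<and> g holomorphic_on ball z e \<and> (\<forall>w\<in>ball z e. the (f w) = (w - z) ^ zero_mult f z * g w)"
proof -
  have "finite_holo_at f z" using sphere_holo_imp_finite_holo_at[OF holo] fz by simp
  then obtain r where r: "r > 0" "\<forall>w\<in>ball z r. f w \<noteq> None" "(\<lambda>w. the (f w)) holomorphic_on ball z r"
    by (rule finite_holo_atE)
  have nz: "\<exists>w\<in>ball z e. the (f w) \<noteq> 0" if "e > 0" for e
  proof -
    have "min e r > 0" using that r(1) by simp
    then obtain w where "w \<in> ball z (min e r)" "f w \<noteq> Some 0" using nconst by blast
    moreover from this have "f w \<noteq> None" using r(2) by simp
    ultimately show ?thesis by (intro bexI[of _ w]) auto
  qed
  show "zero_mult f z > 0"
    "\<exists>g e. e > 0 \<and> g holomorphic_on ball z e \<and> (\<forall>w\<in>ball z e. the (f w) = (w - z) ^ zero_mult f z * g w)"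
    unfolding zero_mult_def
    using holomorphic_factor_local[OF r(3) open_ball _ _ nz] r(1) fz by simp_all
qed

text \<open>Finiteness is asserted separately because a sum over an infinite set is 0 by convention.
  For the same reason the bound is first proved for finite sets of zeros only, in discs of radius
  \<open>r\<close> and then in unit discs.\<close>

lemma N1_zero_count:
  assumes N1: "N1 f" and holo: "sphere_holo f"
  shows "\<exists>C. \<forall>c. finite (zeros f \<inter> cball c 1) \<and> (\<Sum>z\<in>zeros f \<inter> cball c 1. zero_mult f z) \<le> C"
proof -
  have nconst: "\<exists>w\<in>ball z e. f w \<noteq> Some 0" if "e > 0" for z e
    using N1_nonconst[OF N1 holo open_ball, of z e] that by simp
  have norm: "normal_C f" using N1 by (simp add: N1_def)
  obtain s where s: "s > 0" "\<And>z w. dist z w < s \<Longrightarrow> rho_S (f z) (f w) < 1"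
    using normal_C_uniformly_continuous[OF norm holo zero_less_one] by blast
  \<comment> \<open>A point of \<open>ball p (6 * r)\<close> is within \<open>7 * r = s\<close> of
    any zero in \<open>cball p r\<close>, so one such zero forces \<open>|f| < 1\<close> on that
    ball, whose radius exceeds the \<open>5 * r\<close> of the counting bound.\<close>
  define r where "r = s / 7"
  have r: "r > 0" using s(1) by (simp add: r_def)
  obtain m where m: "m > 0" "\<And>a. \<exists>b\<in>ball a r. m \<le> rho_S (f b) (Some 0)"
    using N1_not_uniformly_small[OF N1 holo r] by blast
  \<comment> \<open>With \<open>m / 2 \<le> |f b| \<le> (1/2) ^ k\<close> for the total multiplicity
    \<open>k\<close>, this choice forces \<open>k < N\<close>.\<close>
  obtain N where N: "(1/2) ^ N < m / 2"
    using real_arch_pow_inv[of "m / 2" "1/2"] m(1) by auto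
  have small: "(\<Sum>z\<in>Z. zero_mult f z) \<le> N" if Z: "finite Z" "Z \<subseteq> zeros f \<inter> cball p r" for Z p
  proof (cases "Z = {}")
    case False
    then obtain a where "a \<in> Z" by blast
    hence a: "a \<in> zeros f" "dist p a \<le> r" using Z(2) by auto
    have bd: "f w \<noteq> None" "cmod (the (f w)) < 1" if "w \<in> ball p (6 * r)" for w
    proof -
      have "dist w a < s"
        using that a(2) dist_triangle[of w a p] by (simp add: r_def dist_commute)
      hence "rho_S (f w) (Some 0) < 1" using s(2)[of w a] a(1) by (simp add: zeros_def)
      thus "f w \<noteq> None" "cmod (the (f w)) < 1" by (rule rho_S_zero_less_imp)+
    qed
    obtain b where b: "b \<in> ball p r" "m \<le> rho_S (f b) (Some 0)" using m(2) by blast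
    have "b \<in> ball p (6 * r)" using b(1) r by simp
    hence "f b = Some (the (f b))" using bd(1) by simp
    hence "m / 2 \<le> cmod (the (f b))" using b(2) rho_S_zero_le_imp by metis
    also have "\<dots> \<le> (1/2) ^ (\<Sum>z\<in>Z. zero_mult f z)"
    proof (rule zero_count_bound[OF Z(1), where p = p and r = r and R = "6 * r" and \<phi> = "\<lambda>w. the (f w)" and n = "zero_mult f"])
      show "(\<lambda>w. the (f w)) holomorphic_on ball p (6 * r)"
        by (rule sphere_holo_imp_holomorphic_on[OF holo bd(1)])
      show "\<exists>g e. e > 0 \<and> g holomorphic_on ball z e \<and> (\<forall>w\<in>ball z e. the (f w) = (w - z) ^ zero_mult f z * g w)"
        if "z \<in> Z" for z
        by (rule zero_mult_factor(2)[OF holo _ nconst]) (use that Z(2) in \<open>auto simp: zeros_def\<close>)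
    qed (use Z(2) r b(1) bd(2) in \<open>auto simp: less_imp_le\<close>)
    finally have "(1/2 :: real) ^ N < (1/2) ^ (\<Sum>z\<in>Z. zero_mult f z)" by (rule less_le_trans[OF N])
    hence "(\<Sum>z\<in>Z. zero_mult f z) < N" by (subst (asm) power_strict_decreasing_iff) auto
    thus ?thesis by simp
  qed simp
  \<comment> \<open>One finite cover of the unit disc at 0 serves every centre \<open>c\<close>
    after translation, so the bound \<open>card K * N\<close> is uniform in
    \<open>c\<close>.\<close>
  obtain K where K: "finite K" "cball (0 :: complex) 1 \<subseteq> (\<Union>k\<in>K. ball k r)"
  proof (rule compactE_image[OF compact_cball[of "0 :: complex" 1], of UNIV "\<lambda>k. ball k r"])
    show "cball 0 1 \<subseteq> (\<Union>k\<in>UNIV. ball (k :: complex) r)" using r by (meson UNIV_I UN_I centre_in_ball subsetI)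
  qed (use that in auto)
  have bound: "(\<Sum>z\<in>Z. zero_mult f z) \<le> card K * N" if Z: "finite Z" "Z \<subseteq> zeros f \<inter> cball c 1" for Z c
  proof -
    have "Z \<subseteq> (\<Union>k\<in>K. cball (c + k) r)"
    proof
      fix z assume "z \<in> Z"
      hence "z - c \<in> cball 0 1" using Z(2) by (auto simp: dist_norm norm_minus_commute)
      then obtain k where "k \<in> K" "z - c \<in> ball k r" using K(2) by blast
      hence "z \<in> cball (c + k) r" by (simp add: dist_norm algebra_simps)
      thus "z \<in> (\<Union>k\<in>K. cball (c + k) r)" using \<open>k \<in> K\<close> by blast
    qed
    hence "(\<Sum>z\<in>Z. zero_mult f z) \<le> (\<Sum>k\<in>K. \<Sum>z\<in>Z \<inter> cball (c + k) r. zero_mult f z)"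
      by (rule sum_le_sum_cover[OF K(1) Z(1)])
    also have "\<dots> \<le> (\<Sum>k\<in>K. N)"
      by (intro sum_mono small) (use Z in auto)
    finally show ?thesis by simp
  qed
  have "finite (zeros f \<inter> cball c 1)" for c
  proof -
    \<comment> \<open>Every multiplicity is at least 1, so the cardinalities of finite subsets are
      bounded, which forces the whole set to be finite.\<close>
    have "card Z \<le> card K * N" if Z: "Z \<subseteq> zeros f \<inter> cball c 1" "finite Z" for Z
    proof -
      have "card Z = (\<Sum>z\<in>Z. 1)" by simp
      also have "\<dots> \<le> (\<Sum>z\<in>Z. zero_mult f z)"
      proof (rule sum_mono)
        fix z assume "z \<in> Z"
        hence "f z = Some 0" using Z(1) by (auto simp: zeros_def)
        from zero_mult_factor(1)[OF holo this nconst] show "1 \<le> zero_mult f z" by simp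
      qed
      also have "\<dots> \<le> card K * N" by (rule bound[OF Z(2,1)])
      finally show ?thesis .
    qed
    thus ?thesis using finite_if_finite_subsets_card_bdd by metis
  qed
  thus ?thesis using bound by blast
qed

section \<open>Sufficiency: Arzela-Ascoli, and Cauchy estimates on circles avoiding the
  divisor\<close>

section \<open>The converse\<close>

text \<open>A modulus of continuity for \<open>f\<close> serves all its translates at once, so
  Arzela-Ascoli applies on each disc \<open>cball 0 i\<close>, with uniform bound 1 because images
  lie on the unit sphere. A diagonal subsequence handles all discs together.\<close>

lemma equicontinuous_imp_normal_C:
  assumes uc: "\<And>\<epsilon>. \<epsilon> > 0 \<Longrightarrow> \<exists>d>0. \<forall>z w. dist z w < d \<longrightarrow> rho_S (f z) (f w) < \<epsilon>"
  shows "normal_C f"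
  unfolding normal_C_def
proof
  fix h :: "nat \<Rightarrow> complex"
  define P :: "nat \<Rightarrow> (nat \<Rightarrow> complex) \<Rightarrow> bool" where
    "P i s \<longleftrightarrow> (\<forall>\<epsilon>>0. \<exists>N. \<forall>m\<ge>N. \<forall>n\<ge>N. \<forall>z\<in>cball 0 (real i). rho_S (f (z + s n)) (f (z + s m)) < \<epsilon>)" for i s
  obtain r where r: "strict_mono r" "\<And>i. P i (h \<circ> r)"
  proof (rule subsequence_diagonalization_lemma[of P h])
    fix i and s :: "nat \<Rightarrow> complex"
    let ?F = "\<lambda>n z. stereo (f (z + s n))"
    obtain g k where k: "strict_mono (k :: nat \<Rightarrow> nat)"
      and g: "\<And>e. 0 < e \<Longrightarrow> \<exists>N. \<forall>n z. n \<ge> N \<and> z \<in> cball 0 (real i) \<longrightarrow> norm (?F (k n) z - g z) < e"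
    proof (rule Arzela_Ascoli[of "cball 0 (real i)" ?F 1])
      fix x :: complex and e :: real assume "0 < e"
      then obtain d where d: "d > 0" "\<And>z w. dist z w < d \<Longrightarrow> rho_S (f z) (f w) < e" using uc by blast
      have "norm (?F n x - ?F n y) < e" if "norm (x - y) < d" for n y
        using d(2)[of "x + s n" "y + s n"] that by (simp add: rho_S_eq_dist dist_norm)
      thus "\<exists>d. 0 < d \<and> (\<forall>n y. y \<in> cball 0 (real i) \<and> norm (x - y) < d \<longrightarrow> norm (?F n x - ?F n y) < e)"
        using d(1) by blast
    qed auto
    have "P i (s \<circ> k)"
      unfolding P_def
    proof (intro allI impI)
      fix e :: real assume "e > 0"
      then obtain N where N: "\<And>n z. n \<ge> N \<Longrightarrow> z \<in> cball 0 (real i) \<Longrightarrow> dist (?F (k n) z) (g z) < e / 2"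
        using g[of "e / 2"] unfolding dist_norm by (metis half_gt_zero)
      have "rho_S (f (z + (s \<circ> k) n)) (f (z + (s \<circ> k) m)) < e"
        if "m \<ge> N" "n \<ge> N" "z \<in> cball 0 (real i)" for m n z
        unfolding rho_S_eq_dist o_def using N[OF that(1,3)] N[OF that(2,3)] by (rule dist_triangle_half_l[rotated])
      thus "\<exists>N. \<forall>m\<ge>N. \<forall>n\<ge>N. \<forall>z\<in>cball 0 (real i). rho_S (f (z + (s \<circ> k) n)) (f (z + (s \<circ> k) m)) < e"
        by blast
    qed
    thus "\<exists>k. strict_mono (k :: nat \<Rightarrow> nat) \<and> P i (s \<circ> k)" using k by blast
  next
    fix i and s :: "nat \<Rightarrow> complex" and k1 k2 :: "nat \<Rightarrow> nat" and N
    assume P: "P i (s \<circ> k1)" and sub: "\<And>j. N \<le> j \<Longrightarrow> \<exists>j'. j \<le> j' \<and> k2 j = k1 j'"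
    show "P i (s \<circ> k2)"
      unfolding P_def
    proof (intro allI impI)
      fix e :: real assume "e > 0"
      then obtain M where M: "\<And>m n z. m \<ge> M \<Longrightarrow> n \<ge> M \<Longrightarrow> z \<in> cball 0 (real i) \<Longrightarrow>
          rho_S (f (z + s (k1 n))) (f (z + s (k1 m))) < e"
        using P unfolding P_def o_def by meson
      \<comment> \<open>Only from index \<open>N\<close> on is \<open>k2\<close> drawn from
        \<open>k1\<close>, and then from indices at least as late, so the Cauchy estimate holds
        beyond \<open>max M N\<close>.\<close>
      have "rho_S (f (z + s (k2 n))) (f (z + s (k2 m))) < e"
        if mn: "m \<ge> max M N" "n \<ge> max M N" and z: "z \<in> cball 0 (real i)" for m n z
      proof -
        obtain m' n' where "m \<le> m'" "k2 m = k1 m'" "n \<le> n'" "k2 n = k1 n'"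
          using sub[of m] sub[of n] mn by auto
        thus ?thesis using M[of m' n' z] mn z by simp
      qed
      thus "\<exists>N. \<forall>m\<ge>N. \<forall>n\<ge>N. \<forall>z\<in>cball 0 (real i). rho_S (f (z + (s \<circ> k2) n)) (f (z + (s \<circ> k2) m)) < e"
        unfolding o_def by blast
    qed
  qed (rule that)
  have cauchy: "\<exists>N. \<forall>m\<ge>N. \<forall>n\<ge>N. \<forall>z\<in>K. rho_S (f (z + h (r n))) (f (z + h (r m))) < \<epsilon>"
    if K: "compact K" and \<epsilon>: "\<epsilon> > 0" for K \<epsilon>
  proof -
    obtain B where "\<And>z. z \<in> K \<Longrightarrow> norm z \<le> B"
      using compact_imp_bounded[OF K] by (auto simp: bounded_iff)
    moreover obtain i :: nat where "B \<le> real i" using real_arch_simple by blast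
    ultimately have "K \<subseteq> cball 0 (real i)" by force
    moreover obtain N where "\<forall>m\<ge>N. \<forall>n\<ge>N. \<forall>z\<in>cball 0 (real i). rho_S (f (z + h (r n))) (f (z + h (r m))) < \<epsilon>"
      using r(2)[of i] \<epsilon> unfolding P_def o_def by blast
    ultimately show ?thesis by blast
  qed
  show "\<exists>r :: nat \<Rightarrow> nat. strict_mono r \<and> (\<forall>K. compact K \<longrightarrow> (\<forall>\<epsilon>>0. \<exists>N. \<forall>m\<ge>N. \<forall>n\<ge>N. \<forall>z\<in>K.
      rho_S (f (z + h (r n))) (f (z + h (r m))) < \<epsilon>))"
    by (intro exI[of _ r] conjI allI impI r(1) cauchy)
qed

text \<open>The maximum principle carries the bound \<open>C\<close> from the circle of radius
  \<open>t\<close> to its interior. As \<open>t > s / 2\<close>, discs of radius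
  \<open>s / 4\<close> about points of \<open>ball z0 (s / 4)\<close> fit inside, and Cauchy's
  estimate gives \<open>|f'| \<le> 4 * C / s\<close>; passing to \<open>rho_S\<close> costs a factor
  2.\<close>

lemma sphere_holo_lipschitz:
  assumes holo: "sphere_holo f" and nopole: "poles f \<inter> ball z0 s = {}"
    and t: "s / 2 < t" "t < s" and C: "\<And>z. dist z0 z = t \<Longrightarrow> cmod (the (f z)) \<le> C"
    and w: "dist w z0 < s / 4"
  shows "rho_S (f w) (f z0) \<le> 8 * C / s * dist w z0"
proof -
  let ?\<phi> = "\<lambda>w. the (f w)"
  have s: "s > 0" using w zero_le_dist[of w z0] by linarith
  have fin: "f u \<noteq> None" if "u \<in> ball z0 s" for u
    using nopole that by (auto simp: poles_def)
  have hol: "?\<phi> holomorphic_on ball z0 s"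
    by (rule sphere_holo_imp_holomorphic_on[OF holo fin])
  have sub: "cball z0 t \<subseteq> ball z0 s" using t(2) by auto
  have bd: "cmod (?\<phi> u) \<le> C" if "u \<in> cball z0 t" for u
  proof (rule maximum_modulus_frontier[of ?\<phi> "cball z0 t"])
    show "?\<phi> holomorphic_on interior (cball z0 t)"
      using hol sub by (meson holomorphic_on_subset interior_subset order_trans)
    show "continuous_on (closure (cball z0 t)) ?\<phi>"
      using holomorphic_on_imp_continuous_on[OF hol] sub by (auto intro: continuous_on_subset)
    show "cmod (?\<phi> z) \<le> C" if "z \<in> frontier (cball z0 t)" for z
      using that t(1) s by (intro C) (simp add: frontier_cball)
  qed (use that in auto)
  have der: "cmod (deriv ?\<phi> u) \<le> 4 * C / s" if u: "u \<in> ball z0 (s / 4)" for u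
  proof -
    have sub': "cball u (s / 4) \<subseteq> cball z0 t"
    proof
      fix x assume "x \<in> cball u (s / 4)"
      thus "x \<in> cball z0 t" using u t(1) dist_triangle[of z0 x u] by simp
    qed
    hence hol': "?\<phi> holomorphic_on cball u (s / 4)"
      using hol sub by (meson holomorphic_on_subset order_trans)
    have "cmod ((deriv ^^ 1) ?\<phi> u) \<le> fact 1 * C / (s / 4) ^ 1"
    proof (rule Cauchy_inequality)
      show "?\<phi> holomorphic_on ball u (s / 4)"
        using hol' ball_subset_cball by (rule holomorphic_on_subset)
      show "continuous_on (cball u (s / 4)) ?\<phi>"
        using hol' by (rule holomorphic_on_imp_continuous_on)
      show "cmod (?\<phi> x) \<le> C" if "cmod (u - x) = s / 4" for x
        using sub' that by (intro bd) (auto simp: dist_norm)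
    qed (use s in simp)
    thus ?thesis by (simp add: mult.commute)
  qed
  have "cmod (?\<phi> w - ?\<phi> z0) \<le> 4 * C / s * cmod (w - z0)"
  proof (rule field_differentiable_bound[OF convex_ball])
    fix u assume u: "u \<in> ball z0 (s / 4)"
    hence "u \<in> ball z0 s" using s by auto
    thus "(?\<phi> has_field_derivative deriv ?\<phi> u) (at u within ball z0 (s / 4))"
      using holomorphic_derivI[OF hol open_ball] has_field_derivative_at_within by blast
  qed (use der w s in \<open>auto simp: dist_commute\<close>)
  moreover have "f w = Some (?\<phi> w)" "f z0 = Some (?\<phi> z0)"
    using fin[of w] fin[of z0] w s by (auto simp: dist_commute)
  hence "rho_S (f w) (f z0) \<le> 2 * cmod (?\<phi> w - ?\<phi> z0)"
    using rho_S_Some_le by metis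
  ultimately show ?thesis by (simp add: dist_norm)
qed

text \<open>Pigeonhole: among \<open>N + 1\<close> candidate radii spaced
  \<open>2 * \<delta>\<close> apart, each \<open>x a\<close> is closer than \<open>\<delta>\<close>
  to at most one, and there are at most \<open>N\<close> points \<open>a\<close>.\<close>

lemma exists_avoiding_radius:
  fixes x :: "'a \<Rightarrow> real"
  assumes "finite A" "card A \<le> N" "s > 0"
  shows "\<exists>t. s / 2 < t \<and> t < s \<and> (\<forall>a\<in>A. s / (4 * (real N + 1)) \<le> \<bar>x a - t\<bar>)"
proof (rule ccontr)
  assume neg: "\<not> ?thesis"
  define \<delta> where "\<delta> = s / (4 * (real N + 1))"
  have \<delta>: "\<delta> > 0" "s = 4 * (real N + 1) * \<delta>" using assms(3) by (auto simp: \<delta>_def)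
  \<comment> \<open>Midpoints of the \<open>N + 1\<close> intervals of length
    \<open>2 * \<delta>\<close> that exactly fill the range from \<open>s / 2\<close> to
    \<open>s\<close>.\<close>
  define t where "t j = s / 2 + (2 * real j + 1) * \<delta>" for j
  have "\<exists>a\<in>A. \<bar>x a - t j\<bar> < \<delta>" if "j \<le> N" for j
  proof -
    have "(2 * real j + 1) * \<delta> < (2 * real N + 2) * \<delta>" "0 < (2 * real j + 1) * \<delta>"
      using \<delta>(1) that by (auto intro!: mult_strict_right_mono)
    moreover have "s = 2 * ((2 * real N + 2) * \<delta>)" using \<delta>(2) by (simp add: algebra_simps)
    ultimately have "s / 2 < t j" "t j < s" unfolding t_def by linarith+
    thus ?thesis using neg by (force simp: \<delta>_def not_le)
  qed
  then obtain a where a: "\<And>j. j \<le> N \<Longrightarrow> a j \<in> A" "\<And>j. j \<le> N \<Longrightarrow> \<bar>x (a j) - t j\<bar> < \<delta>" by metis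
  have "inj_on a {..N}"
  proof (rule inj_onI)
    fix i j assume ij: "i \<in> {..N}" "j \<in> {..N}" "a i = a j"
    have "\<bar>t i - t j\<bar> < 2 * \<delta>" using a(2)[of i] a(2)[of j] ij by auto
    also have "t i - t j = (2 * \<delta>) * (real i - real j)" by (simp add: t_def algebra_simps)
    finally have "(2 * \<delta>) * \<bar>real i - real j\<bar> < (2 * \<delta>) * 1" using \<delta>(1) by (simp add: abs_mult)
    hence "\<bar>real i - real j\<bar> < 1" using \<delta>(1) by (subst (asm) mult_less_cancel_left_pos) auto
    thus "i = j" by linarith
  qed
  hence "card {..N} \<le> card A" using a(1) assms(1) by (intro card_inj_on_le) auto
  thus False using assms(2) by simp
qed

lemma divisor_conditions_imp_equicontinuous:
  assumes holo: "sphere_holo f"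
    and bounds: "\<And>\<delta>. \<delta> > 0 \<Longrightarrow> \<exists>C>0. \<forall>z. (\<forall>a\<in>zeros f. z \<notin> ball a \<delta>) \<and> (\<forall>b\<in>poles f. z \<notin> ball b \<delta>) \<longrightarrow>
      (\<exists>w. f z = Some w \<and> 1 / C \<le> cmod w \<and> cmod w \<le> C)"
    and d: "d > 0" "\<And>a b. a \<in> zeros f \<Longrightarrow> b \<in> poles f \<Longrightarrow> d \<le> cmod (a - b)"
    and fin: "\<And>c. finite ((zeros f \<union> poles f) \<inter> cball c 1)"
    and card: "\<And>c. card ((zeros f \<union> poles f) \<inter> cball c 1) \<le> N"
    and "\<epsilon> > 0"
  shows "\<exists>d>0. \<forall>z w. dist z w < d \<longrightarrow> rho_S (f z) (f w) < \<epsilon>"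
proof -
  \<comment> \<open>\<open>2 * s \<le> d\<close> prevents a disc of radius \<open>s\<close> from
    containing both a zero and a pole; \<open>s \<le> 1/2\<close> keeps its circles away from
    divisor points outside \<open>cball z0 1\<close>.\<close>
  define s where "s = min d 1 / 2"
  have s: "s > 0" "2 * s \<le> d" "s \<le> 1 / 2" using d(1) by (auto simp: s_def)
  define \<delta> where "\<delta> = s / (4 * (real N + 1))"
  have "\<delta> \<le> s / 4" unfolding \<delta>_def using s(1) by (intro divide_left_mono) auto
  hence \<delta>: "\<delta> > 0" "\<delta> \<le> 1 / 8" using s by (auto simp: \<delta>_def)
  obtain C where C: "C > 0" and off: "\<And>z. \<forall>a\<in>zeros f. z \<notin> ball a \<delta> \<Longrightarrow> \<forall>b\<in>poles f. z \<notin> ball b \<delta> \<Longrightarrow>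
      \<exists>w. f z = Some w \<and> 1 / C \<le> cmod w \<and> cmod w \<le> C"
    using bounds[OF \<delta>(1)] by blast
  have lip: "rho_S (f w) (f z0) \<le> 8 * C / s * dist w z0" if w: "dist w z0 < s / 4" for z0 w
  proof -
    let ?A = "(zeros f \<union> poles f) \<inter> cball z0 1"
    obtain t where t: "s / 2 < t" "t < s" "\<And>a. a \<in> ?A \<Longrightarrow> \<delta> \<le> \<bar>dist z0 a - t\<bar>"
      using exists_avoiding_radius[OF fin card s(1), of z0 "\<lambda>a. dist z0 a"] unfolding \<delta>_def by blast
    have circle: "\<exists>w. f z = Some w \<and> 1 / C \<le> cmod w \<and> cmod w \<le> C" if z: "dist z0 z = t" for z
    proof -
      have "\<delta> \<le> dist a z" if "a \<in> zeros f \<union> poles f" for a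
      proof (cases "dist z0 a \<le> 1")
        case True
        hence "\<delta> \<le> \<bar>dist z0 a - t\<bar>" using that by (intro t(3)) auto
        thus ?thesis using z dist_triangle[of z0 a z] dist_triangle[of z0 z a]
          by (simp add: dist_commute abs_if split: if_splits)
      next
        \<comment> \<open>A point at distance more than 1 from \<open>z0\<close> is more than
          \<open>1 - t > 1/2\<close> away from the circle, beyond
          \<open>\<delta> \<le> 1/8\<close>.\<close>
        case False
        thus ?thesis using z t(2) s(3) \<delta>(2) dist_triangle[of z0 a z] by (simp add: dist_commute)
      qed
      thus ?thesis by (intro off) (auto simp: not_less)
    qed
    show ?thesis
    proof (cases "poles f \<inter> ball z0 s = {}")
      case True
      show ?thesis
        by (rule sphere_holo_lipschitz[OF holo True t(1,2) _ w]) (use circle in force)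
    next
      \<comment> \<open>A pole in the disc excludes zeros, so \<open>1/f\<close> is holomorphic
        there, and the lower bound \<open>1 / C\<close> for \<open>|f|\<close> on the circle bounds
        it by \<open>C\<close>.\<close>
      case False
      then obtain b where b: "b \<in> poles f" "dist z0 b < s" by auto
      have "zeros f \<inter> ball z0 s = {}"
      proof (rule ccontr)
        assume "\<not> ?thesis"
        then obtain a where a: "a \<in> zeros f" "dist z0 a < s" by auto
        have "dist a b < 2 * s" using a(2) b(2) dist_triangle[of a b z0] by (simp add: dist_commute)
        thus False using d(2)[OF a(1) b(1)] s(2) by (simp add: dist_norm)
      qed
      hence nopole: "poles (recip f) \<inter> ball z0 s = {}" by simp
      have "rho_S (recip f w) (recip f z0) \<le> 8 * C / s * dist w z0"
      proof (rule sphere_holo_lipschitz[OF sphere_holo_recip[OF holo] nopole t(1,2) _ w])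
        fix z assume "dist z0 z = t"
        then obtain v where v: "f z = Some v" "1 / C \<le> cmod v" using circle by blast
        have v0: "cmod v > 0" using v(2) C by (smt (verit) divide_pos_pos)
        hence eq: "the (recip f z) = 1 / v" using v(1) by (auto simp: recip_def)
        show "cmod (the (recip f z)) \<le> C"
          unfolding eq using v(2) v0 C by (simp add: norm_divide field_simps)
      qed
      thus ?thesis by simp
    qed
  qed
  define d' where "d' = min (s / 4) (\<epsilon> * s / (8 * C))"
  have "rho_S (f z) (f w) < \<epsilon>" if "dist z w < d'" for z w
  proof -
    have "rho_S (f z) (f w) \<le> 8 * C / s * dist z w" using that by (intro lip) (simp add: d'_def)
    also have "\<dots> < \<epsilon>"
      using that s(1) C by (simp add: d'_def field_simps)
    finally show ?thesis .
  qed
  moreover have "d' > 0" using s(1) C \<open>\<epsilon> > 0\<close> by (simp add: d'_def)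
  ultimately show ?thesis by blast
qed

text \<open>A single late translate suffices: a disc of radius \<open>R\<close> contains a zero and
  a pole, so \<open>c\<close> would be within 1 of both 0 and infinity, which are 2 apart.\<close>

lemma no_constant_limit:
  assumes dense: "\<And>w. (\<exists>a\<in>zeros f. a \<in> ball w R) \<and> (\<exists>b\<in>poles f. b \<in> ball w R)"
  shows "\<not> (\<exists>(h :: nat \<Rightarrow> complex) c. \<forall>K. compact K \<longrightarrow> (\<forall>\<epsilon>>0. \<exists>N. \<forall>n\<ge>N. \<forall>z\<in>K. rho_S (f (z + h n)) c < \<epsilon>))"
proof
  assume "\<exists>(h :: nat \<Rightarrow> complex) c. \<forall>K. compact K \<longrightarrow> (\<forall>\<epsilon>>0. \<exists>N. \<forall>n\<ge>N. \<forall>z\<in>K. rho_S (f (z + h n)) c < \<epsilon>)"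
  then obtain h :: "nat \<Rightarrow> complex" and c where
    "\<forall>K. compact K \<longrightarrow> (\<forall>\<epsilon>>0. \<exists>N. \<forall>n\<ge>N. \<forall>z\<in>K. rho_S (f (z + h n)) c < \<epsilon>)"
    by (elim exE)
  from this[rule_format, OF compact_cball zero_less_one, of 0 R]
  obtain N where N: "\<And>n z. n \<ge> N \<Longrightarrow> z \<in> cball 0 R \<Longrightarrow> rho_S (f (z + h n)) c < 1" by blast
  have near: "rho_S (f a) c < 1" if "a \<in> ball (h N) R" for a
    using N[of N "a - h N"] that by (simp add: dist_norm norm_minus_commute)
  obtain a b where "a \<in> zeros f" "a \<in> ball (h N) R" "b \<in> poles f" "b \<in> ball (h N) R"
    using dense by blast
  hence "rho_S (Some 0) c < 1" "rho_S None c < 1"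
    using near[of a] near[of b] by (auto simp: zeros_def poles_def)
  hence "rho_S (Some 0) None < 2"
    unfolding rho_S_eq_dist using dist_triangle2[of "stereo (Some 0)" "stereo None" "stereo c"] by linarith
  thus False by (simp add: rho_S_zero_infinity)
qed

text \<open>Local finiteness of the zeros keeps \<open>f\<close> from vanishing on a disc, so each
  multiplicity is a genuine order and at least 1.\<close>

lemma card_le_sum_zero_mult:
  assumes "sphere_holo f" "\<And>c. finite (zeros f \<inter> cball c 1)"
  shows "card (zeros f \<inter> cball c 1) \<le> (\<Sum>a\<in>zeros f \<inter> cball c 1. zero_mult f a)"
proof -
  have "zero_mult f a > 0" if "a \<in> zeros f" for a
  proof (rule zero_mult_factor(1)[OF assms(1)])
    show "f a = Some 0" using that by (simp add: zeros_def)
    fix e :: real assume "e > 0"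
    show "\<exists>w\<in>ball a e. f w \<noteq> Some 0"
    proof (rule ccontr)
      assume "\<not> ?thesis"
      hence "ball a (min e 1) \<subseteq> zeros f \<inter> cball a 1" by (auto simp: zeros_def)
      hence "finite (ball a (min e 1))" using assms(2) finite_subset by blast
      thus False using uncountable_ball[of "min e 1" a] \<open>e > 0\<close> countable_finite by force
    qed
  qed
  hence "(\<Sum>a\<in>zeros f \<inter> cball c 1. 1) \<le> (\<Sum>a\<in>zeros f \<inter> cball c 1. zero_mult f a)"
    by (intro sum_mono) (simp add: Suc_leI)
  thus ?thesis by simp
qed

text \<open>The divisor is encoded by the sets \<open>zeros f\<close> and \<open>poles f\<close>
  weighted with \<open>zero_mult\<close> and \<open>pole_mult\<close>. Finiteness stands next to the
  count since infinite sums default to 0, and the positive infimum is expressed by a lower bound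
  \<open>d > 0\<close>.\<close>

theorem mainTheorem11:
  fixes f :: "complex \<Rightarrow> complex option"
  assumes "meromorphic_C f"
  shows "N1 f \<longleftrightarrow>
    ((\<forall>\<delta>>0. \<exists>C>0. \<forall>z.
        ((\<forall>a\<in>zeros f. z \<notin> ball a \<delta>) \<and> (\<forall>b\<in>poles f. z \<notin> ball b \<delta>)) \<longrightarrow>
        (\<exists>w. f z = Some w \<and> 1 / C \<le> cmod w \<and> cmod w \<le> C)) \<and>
     (\<exists>d>0. \<forall>a\<in>zeros f. \<forall>b\<in>poles f. d \<le> cmod (a - b)) \<and>
     (\<exists>C0. \<forall>c. finite (zeros f \<inter> cball c 1) \<and> finite (poles f \<inter> cball c 1) \<and>
        real ((\<Sum>a\<in>zeros f \<inter> cball c 1. zero_mult f a) + (\<Sum>b\<in>poles f \<inter> cball c 1. pole_mult f b)) < C0) \<and>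
     (\<exists>R0. \<forall>w. (\<exists>a\<in>zeros f. a \<in> ball w R0) \<and> (\<exists>b\<in>poles f. b \<in> ball w R0)))"
    (is "_ \<longleftrightarrow> ?a \<and> ?sep \<and> ?count \<and> ?dense")
proof -
  have holo: "sphere_holo f" using assms by (rule meromorphic_C_imp_sphere_holo)
  hence holo': "sphere_holo (recip f)" by (rule sphere_holo_recip)
  show ?thesis
  proof (intro iffI conjI)
    assume N1: "N1 f"
    hence N1': "N1 (recip f)" by (rule N1_recip)
    show ?a using N1_bounds_off_divisor[OF N1 holo] by blast
    show ?sep using zeros_poles_separated[OF _ holo] N1 by (simp add: N1_def)
    obtain B where B: "\<And>c. finite (zeros f \<inter> cball c 1)" "\<And>c. (\<Sum>z\<in>zeros f \<inter> cball c 1. zero_mult f z) \<le> B"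
      using N1_zero_count[OF N1 holo] by blast
    obtain B' where B': "\<And>c. finite (poles f \<inter> cball c 1)" "\<And>c. (\<Sum>z\<in>poles f \<inter> cball c 1. pole_mult f z) \<le> B'"
      using N1_zero_count[OF N1' holo'] unfolding zeros_recip pole_mult_def by blast
    show ?count
    proof (intro exI allI conjI)
      fix c
      show "real ((\<Sum>a\<in>zeros f \<inter> cball c 1. zero_mult f a) + (\<Sum>b\<in>poles f \<inter> cball c 1. pole_mult f b)) < real (B + B') + 1"
        using B(2)[of c] B'(2)[of c] by linarith
    qed (rule B B')+
    obtain R where R: "\<And>w. \<exists>a\<in>zeros f. a \<in> ball w R"
      using N1_zeros_relatively_dense[OF N1 holo] by blast
    obtain R' where R': "\<And>w. \<exists>b\<in>poles f. b \<in> ball w R'"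
      using N1_zeros_relatively_dense[OF N1' holo'] unfolding zeros_recip by blast
    have "ball w R \<subseteq> ball w (max R R')" "ball w R' \<subseteq> ball w (max R R')" for w :: complex
      by auto
    thus ?dense using R R' by (intro exI[of _ "max R R'"]) blast
  next
    assume *: "?a \<and> ?sep \<and> ?count \<and> ?dense"
    from * have bounds: ?a by blast
    from * obtain d where d: "d > 0" "\<And>a b. a \<in> zeros f \<Longrightarrow> b \<in> poles f \<Longrightarrow> d \<le> cmod (a - b)" by blast
    from * obtain C0 where fin: "\<And>c. finite (zeros f \<inter> cball c 1)" "\<And>c. finite (poles f \<inter> cball c 1)"
      and C0: "\<And>c. real ((\<Sum>a\<in>zeros f \<inter> cball c 1. zero_mult f a) + (\<Sum>b\<in>poles f \<inter> cball c 1. pole_mult f b)) < C0"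
      by blast
    from * obtain R where R: "\<And>w. (\<exists>a\<in>zeros f. a \<in> ball w R) \<and> (\<exists>b\<in>poles f. b \<in> ball w R)" by blast
    \<comment> \<open>The choice of radii depends on the number of distinct divisor points, which
      the count with multiplicity dominates.\<close>
    have "card ((zeros f \<union> poles f) \<inter> cball c 1) \<le> nat \<lceil>C0\<rceil>" for c
    proof -
      have "card ((zeros f \<union> poles f) \<inter> cball c 1) \<le> card (zeros f \<inter> cball c 1) + card (poles f \<inter> cball c 1)"
        unfolding Int_Un_distrib2 by (rule card_Un_le)
      also have "\<dots> \<le> (\<Sum>a\<in>zeros f \<inter> cball c 1. zero_mult f a) + (\<Sum>b\<in>poles f \<inter> cball c 1. pole_mult f b)"
        using card_le_sum_zero_mult[OF holo fin(1), of c] card_le_sum_zero_mult[OF holo', of c] fin(2)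
        by (simp add: pole_mult_def)
      finally show ?thesis using C0[of c] by linarith
    qed
    hence "\<exists>d>0. \<forall>z w. dist z w < d \<longrightarrow> rho_S (f z) (f w) < \<epsilon>" if "\<epsilon> > 0" for \<epsilon>
      using divisor_conditions_imp_equicontinuous[OF holo _ d, of "nat \<lceil>C0\<rceil>" \<epsilon>] bounds fin that
      by (simp add: Int_Un_distrib2)
    hence "normal_C f" by (rule equicontinuous_imp_normal_C)
    thus "N1 f" using no_constant_limit[OF R] by (simp add: N1_def)
  qed
qed

end
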